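(* Let $d\ge2$ be an integer and $c_*=(d-1)^{d-1}$. For $c\in\mathbb{R}$ let $\delta_n=\delta_n(c)$ denote the coefficient of $x_1^n\cdots x_d^n$ in the power series expansion at the origin of $$F_{c,d}(x_1,\dots,x_d)=\frac{1}{1-e_1+c\,e_d}.$$ Then $$\lim_{c\to c_*}\ \limsup_{n\to\infty}|\delta_n(c)|^{1/(dn)}=d-1,$$ where the limit is over real $c\ne c_*$ tending to $c_*$ (from either side).
   Context: $e_1=x_1+\cdots+x_d$ and $e_d=x_1x_2\cdots x_d$. *)

theory Defs
  imports "HOL-Analysis.Analysis"
begin

text \<open>
  Points of d-space are functions on the naturals of which only the values at the indices
  \<open>i < d\<close> matter; exponent vectors are the functions in
  \<open>{..<d} \<rightarrow>\<^sub>E UNIV\<close>, so that each exponent vector is represented exactly once.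
\<close>

definition e_first :: "nat \<Rightarrow> (nat \<Rightarrow> real) \<Rightarrow> real" where
  "e_first d x = (\<Sum>i<d. x i)"

definition e_last :: "nat \<Rightarrow> (nat \<Rightarrow> real) \<Rightarrow> real" where
  "e_last d x = (\<Prod>i<d. x i)"

definition F :: "real \<Rightarrow> nat \<Rightarrow> (nat \<Rightarrow> real) \<Rightarrow> real" where
  "F c d x = 1 / (1 - e_first d x + c * e_last d x)"

definition exponents :: "nat \<Rightarrow> (nat \<Rightarrow> nat) set" where
  "exponents d = {..<d} \<rightarrow>\<^sub>E UNIV"

definition has_powser_expansion ::
    "nat \<Rightarrow> ((nat \<Rightarrow> real) \<Rightarrow> real) \<Rightarrow> ((nat \<Rightarrow> nat) \<Rightarrow> real) \<Rightarrow> bool" where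
  "has_powser_expansion d f a \<longleftrightarrow>
     (\<exists>\<rho>>0. \<forall>x. (\<forall>i<d. \<bar>x i\<bar> < \<rho>) \<longrightarrow>
        ((\<lambda>r. a r * (\<Prod>i<d. x i ^ r i)) has_sum f x) (exponents d))"

text \<open>
  An expansion leaves \<open>a\<close> arbitrary outside \<open>exponents d\<close>, so the description
  operator is applied to the single coefficient, which is unique for
  \<open>r \<in> exponents d\<close> whenever \<open>f\<close> has an expansion.
\<close>

definition powser_coeff ::
    "nat \<Rightarrow> ((nat \<Rightarrow> real) \<Rightarrow> real) \<Rightarrow> (nat \<Rightarrow> nat) \<Rightarrow> real" where
  "powser_coeff d f r = (THE v. \<exists>a. has_powser_expansion d f a \<and> a r = v)"

definition delta :: "nat \<Rightarrow> real \<Rightarrow> nat \<Rightarrow> real" where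
  "delta d c n = powser_coeff d (F c d) (\<lambda>i\<in>{..<d}. n)"

end

theory Submission
  imports Defs "HOL-Complex_Analysis.Complex_Analysis"
begin

text \<open>
  Expanding \<open>F\<close> gives \<open>\<delta>\<^sub>n = (\<Sum>j\<le>n. A\<^sub>j (d j + n - j choose n - j) (- c) ^ (n - j))\<close> with the
  multinomial coefficients \<open>A\<^sub>j = (d j)! / j! ^ d\<close>. Hence the diagonal series is
  \<open>\<Delta>(t) = H(t / (1 + c t) ^ d) / (1 + c t)\<close>, where \<open>H(z) = (\<Sum>j. A\<^sub>j z ^ j)\<close> has its only finite
  singularity at \<open>d ^ - d\<close>. For \<open>c\<close> equal to \<open>(d - 1) ^ (d - 1)\<close> the equation
  \<open>t / (1 + c t) ^ d = d ^ - d\<close> has the double root \<open>(d - 1) ^ - d\<close>, which splits into two simple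
  roots when \<open>c\<close> moves.

  Upper bound: \<open>A\<^sub>j\<close> is the \<open>j\<close>-th moment of a probability measure on \<open>{0..d ^ d}\<close>, so
  \<open>|\<delta>\<^sub>n|\<close> is at most the supremum over \<open>x\<close> in that interval of the \<open>n\<close>-th Taylor coefficient of
  \<open>(1 + c t) ^ (d - 1) / ((1 + c t) ^ d - x t)\<close>, which the Cauchy inequality controls.

  Lower bound: if \<open>\<Delta>\<close> converged beyond the roots, then \<open>H\<close> would have bounded derivatives
  near \<open>d ^ - d\<close>; but \<open>A\<^sub>j\<close> is \<open>d ^ (d j)\<close> up to a polynomial factor.
\<close>

section \<open>The coefficients of the expansion\<close>

lemma powser_coeff_eq:
  fixes a b :: "nat \<Rightarrow> 'a::{real_normed_field,banach}"
  assumes "r > 0"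
    and a: "\<And>x. norm x < r \<Longrightarrow> (\<lambda>n. a n * x ^ n) sums f x"
    and b: "\<And>x. norm x < r \<Longrightarrow> (\<lambda>n. b n * x ^ n) sums f x"
  shows "a n = b n"
proof (rule ccontr)
  assume neq: "a n \<noteq> b n"
  define D where "D = (\<lambda>n. a n - b n)"
  have D: "(\<lambda>n. D n * x ^ n) sums 0" if "norm x < r" for x
    using sums_diff[OF a[OF that] b[OF that]] by (simp add: D_def algebra_simps)
  have "D 0 = 0"
    using D[of 0] \<open>r > 0\<close> powser_sums_zero[of D] sums_unique2 by fastforce
  moreover have "D n \<noteq> 0" using neq by (simp add: D_def)
  ultimately have "n > 0" by (cases n) auto
  \<comment> \<open>Zeros of a power series with a nonzero coefficient are isolated. For the zero
    function this claims \<open>0 \<noteq> 0\<close> on a punctured ball, which contains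
    \<open>of_real s\<close>.\<close>
  obtain s where "s > 0" and s: "\<And>z. z \<in> cball (0::'a) s - {0} \<Longrightarrow> (0::'a) \<noteq> 0"
    by (rule powser_0_nonzero[of r 0 D "\<lambda>_. 0" n]) (use D \<open>r > 0\<close> \<open>n > 0\<close> \<open>D n \<noteq> 0\<close> in auto)
  from s[of "of_real s"] \<open>s > 0\<close> show False by simp
qed

text \<open>Splits off the last exponent, which makes induction on the number of variables
  possible.\<close>

lemma has_sum_exponents_Suc:
  "((\<lambda>r. f r) has_sum S) (exponents (Suc d)) \<longleftrightarrow>
     ((\<lambda>(q, n). f (q(d := n))) has_sum S) (exponents d \<times> UNIV)"
proof -
  have "bij_betw (\<lambda>(q, n). q(d := n)) (exponents d \<times> UNIV) (exponents (Suc d))"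
  proof (rule bij_betw_byWitness[where f' = "\<lambda>r. (r(d := undefined), r d)"])
    show "\<forall>a\<in>exponents d \<times> UNIV.
            (\<lambda>r. (r(d := undefined), r d)) (case a of (q, n) \<Rightarrow> q(d := n)) = a"
      by (auto simp: exponents_def PiE_def extensional_def fun_eq_iff)
  qed (auto simp: exponents_def PiE_def extensional_def fun_eq_iff)
  from has_sum_reindex_bij_betw[OF this, of f S] show ?thesis
    by (simp add: case_prod_unfold)
qed

text \<open>The identity theorem in \<open>d\<close> variables, quantified over \<open>a\<close> so
  that the induction hypothesis covers every family obtained by freezing the last exponent.\<close>

definition coeffs_vanish :: "real \<Rightarrow> nat \<Rightarrow> bool" where
  "coeffs_vanish \<rho> d \<longleftrightarrow> (\<forall>a. (\<forall>x. (\<forall>i<d. \<bar>x i\<bar> < \<rho>) \<longrightarrow>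
             ((\<lambda>r. a r * (\<Prod>i<d. x i ^ r i)) has_sum (0::real)) (exponents d)) \<longrightarrow>
           (\<forall>r\<in>exponents d. a r = 0))"

lemma coeffs_vanishD:
  assumes "coeffs_vanish \<rho> d"
    and "\<And>x. (\<forall>i<d. \<bar>x i\<bar> < \<rho>) \<Longrightarrow> ((\<lambda>r. a r * (\<Prod>i<d. x i ^ r i)) has_sum (0::real)) (exponents d)"
    and "r \<in> exponents d"
  shows "a r = 0"
  using assms unfolding coeffs_vanish_def by blast

text \<open>Induction on the number of variables. With the first \<open>d\<close> variables fixed,
  the sum is a power series in the last one with coefficients \<open>C x n\<close>, which vanish by
  the one-variable case. As \<open>C x n\<close> is itself a series in the first \<open>d\<close>
  variables, the induction hypothesis applies to it.\<close>

lemma coeffs_vanish_if_pos: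
  assumes "\<rho> > 0"
  shows "coeffs_vanish \<rho> d"
proof (induction d)
  case 0
  show ?case
    unfolding coeffs_vanish_def
  proof (intro allI impI ballI)
    fix a :: "(nat \<Rightarrow> nat) \<Rightarrow> real" and r
    assume H: "\<forall>x. (\<forall>i<0. \<bar>x i\<bar> < \<rho>) \<longrightarrow> ((\<lambda>r. a r * (\<Prod>i<0. x i ^ r i)) has_sum 0) (exponents 0)"
      and r: "r \<in> exponents 0"
    have "exponents 0 = {r}" using r by (auto simp: exponents_def)
    with H have "(a has_sum 0) {r}" by simp
    moreover have "(a has_sum a r) {r}" by (rule has_sum_finiteI) auto
    ultimately show "a r = 0" by (rule has_sum_unique[rotated])
  qed
next
  case (Suc d)
  show ?case
    unfolding coeffs_vanish_def
  proof (intro allI impI ballI)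
    fix a :: "(nat \<Rightarrow> nat) \<Rightarrow> real" and r
    assume H: "\<forall>x. (\<forall>i<Suc d. \<bar>x i\<bar> < \<rho>) \<longrightarrow> ((\<lambda>r. a r * (\<Prod>i<Suc d. x i ^ r i)) has_sum 0) (exponents (Suc d))"
      and r: "r \<in> exponents (Suc d)"
    define C where "C = (\<lambda>x n. \<Sum>\<^sub>\<infinity>q\<in>exponents d. a (q(d := n)) * (\<Prod>i<d. x i ^ q i))"
    have *: "((\<lambda>(n, q). a (q(d := n)) * (\<Prod>i<d. x i ^ q i) * y ^ n) has_sum 0) (UNIV \<times> exponents d)"
      if "\<forall>i<d. \<bar>x i\<bar> < \<rho>" "\<bar>y\<bar> < \<rho>" for x y
    proof -
      have "\<forall>i<Suc d. \<bar>(x(d := y)) i\<bar> < \<rho>"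
        using that by (auto simp: less_Suc_eq)
      then have "((\<lambda>r. a r * (\<Prod>i<Suc d. (x(d := y)) i ^ r i)) has_sum 0) (exponents (Suc d))"
        by (rule H[THEN spec, THEN mp])
      then have "((\<lambda>(q, n). a (q(d := n)) * (\<Prod>i<d. x i ^ q i) * y ^ n) has_sum 0) (exponents d \<times> UNIV)"
        unfolding has_sum_exponents_Suc by (simp add: mult.assoc)
      from has_sum_swap[THEN iffD1, OF this] show ?thesis by (simp add: case_prod_unfold)
    qed
    have **: "((\<lambda>q. a (q(d := n)) * (\<Prod>i<d. x i ^ q i)) has_sum C x n) (exponents d)"
      if x: "\<forall>i<d. \<bar>x i\<bar> < \<rho>" for x n
    proof -
      \<comment> \<open>The last variable is set to a nonzero value below \<open>\<rho>\<close>, so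
        that its power can be divided out, leaving summability for fixed \<open>n\<close>.\<close>
      have "(\<lambda>(n, q). a (q(d := n)) * (\<Prod>i<d. x i ^ q i) * (\<rho>/2) ^ n) summable_on (UNIV \<times> exponents d)"
        using *[OF x, of "\<rho>/2"] \<open>\<rho> > 0\<close> by (auto intro: has_sum_imp_summable)
      then have "(\<lambda>q. a (q(d := n)) * (\<Prod>i<d. x i ^ q i) * (\<rho>/2) ^ n) summable_on exponents d"
        by (rule summable_on_SigmaD1) simp
      then show ?thesis
        using \<open>\<rho> > 0\<close> unfolding C_def by (subst (asm) summable_on_cmult_left') auto
    qed
    have C: "C x n = 0" if x: "\<forall>i<d. \<bar>x i\<bar> < \<rho>" for x n
    proof (rule powser_coeff_eq[OF \<open>\<rho> > 0\<close>, where f = "\<lambda>_. 0"])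
      fix y :: real assume "norm y < \<rho>"
      then have "((\<lambda>n. C x n * y ^ n) has_sum 0) UNIV"
        using x by (intro has_sum_SigmaD[OF *[of x y]]) (auto intro!: has_sum_cmult_left **)
      then show "(\<lambda>n. C x n * y ^ n) sums 0" by (rule has_sum_imp_sums)
    qed auto
    have "(r(d := undefined)) \<in> exponents d"
      using r by (auto simp: exponents_def PiE_def extensional_def)
    from coeffs_vanishD[where a = "\<lambda>q. a (q(d := r d))", OF Suc.IH _ this]
    have "a ((r(d := undefined))(d := r d)) = 0"
      using **[where n = "r d"] C[where n = "r d"] by simp
    then show "a r = 0" by simp
  qed
qed

lemma powser_coeff_eqI:
  assumes a: "has_powser_expansion d f a" and r: "r \<in> exponents d"
  shows "powser_coeff d f r = a r"
  unfolding powser_coeff_def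
proof (rule the_equality)
  fix v assume "\<exists>a. has_powser_expansion d f a \<and> a r = v"
  then obtain b where b: "has_powser_expansion d f b" "b r = v" by blast
  obtain \<rho> where \<rho>: "\<rho> > 0"
    "\<forall>x. (\<forall>i<d. \<bar>x i\<bar> < \<rho>) \<longrightarrow> ((\<lambda>r. a r * (\<Prod>i<d. x i ^ r i)) has_sum f x) (exponents d)"
    using a unfolding has_powser_expansion_def by blast
  obtain \<rho>' where \<rho>': "\<rho>' > 0"
    "\<forall>x. (\<forall>i<d. \<bar>x i\<bar> < \<rho>') \<longrightarrow> ((\<lambda>r. b r * (\<Prod>i<d. x i ^ r i)) has_sum f x) (exponents d)"
    using b(1) unfolding has_powser_expansion_def by blast
  have *: "((\<lambda>r. (a r - b r) * (\<Prod>i<d. x i ^ r i)) has_sum 0) (exponents d)"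
    if "\<forall>i<d. \<bar>x i\<bar> < min \<rho> \<rho>'" for x
  proof -
    have "((\<lambda>r. a r * (\<Prod>i<d. x i ^ r i) + - (b r * (\<Prod>i<d. x i ^ r i))) has_sum f x + - f x) (exponents d)"
      by (intro has_sum_add has_sum_uminusI \<rho>(2)[THEN spec, THEN mp] \<rho>'(2)[THEN spec, THEN mp])
         (use that in auto)
    then show ?thesis by (simp add: algebra_simps)
  qed
  have "coeffs_vanish (min \<rho> \<rho>') d"
    using \<rho>(1) \<rho>'(1) by (intro coeffs_vanish_if_pos) simp
  from coeffs_vanishD[where a = "\<lambda>r. a r - b r", OF this * r] have "a r - b r = 0" by simp
  then show "v = a r" using b by simp
qed (use a in blast)

section \<open>Negative binomial and multinomial series\<close>

lemma neg_binomial_sums_complex: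
  fixes u :: complex
  assumes "norm u < 1"
  shows "(\<lambda>k. of_nat ((N + k) choose k) * u ^ k) sums (1 / (1 - u) ^ Suc N)"
proof -
  have u: "1 - u \<noteq> 0" using assms by auto
  \<comment> \<open>Newton's binomial series with exponent \<open>- (N + 1)\<close>; negating the
    upper index turns its coefficients into ordinary binomial coefficients.\<close>
  have "(\<lambda>k. ((- of_nat (Suc N)) gchoose k) * (- u) ^ k) sums (1 + - u) powr (- of_nat (Suc N))"
    using assms by (intro gen_binomial_complex) simp
  moreover have "((- of_nat (Suc N)) gchoose k) * (- u) ^ k = of_nat ((N + k) choose k) * u ^ k" for k
  proof -
    have "(- of_nat (Suc N) :: complex) gchoose k = (- 1) ^ k * (of_nat (N + k) gchoose k)"
      by (subst gbinomial_negated_upper) (simp add: add.commute)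
    then show ?thesis
      by (simp add: binomial_gbinomial power_minus' mult.assoc)

  qed
  moreover have "(1 + - u) powr (- of_nat (Suc N)) = 1 / (1 - u) ^ Suc N"
    using u by (simp add: powr_minus powr_nat divide_inverse del: of_nat_Suc power_Suc)
  ultimately show ?thesis by simp
qed

lemma neg_binomial_sums_real:
  fixes u :: real
  assumes "\<bar>u\<bar> < 1"
  shows "(\<lambda>k. of_nat ((N + k) choose k) * u ^ k) sums (1 / (1 - u) ^ Suc N)"
proof -
  have "(\<lambda>k. complex_of_real (of_nat ((N + k) choose k) * u ^ k)) sums of_real (1 / (1 - u) ^ Suc N)"
    using neg_binomial_sums_complex[of "of_real u" N] assms by simp
  then show ?thesis by (simp only: sums_of_real_iff)
qed

lemma neg_binomial_has_sum_real:
  fixes u :: real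
  assumes "\<bar>u\<bar> < 1"
  shows "((\<lambda>k. of_nat ((N + k) choose k) * u ^ k) has_sum (1 / (1 - u) ^ Suc N)) UNIV"
  using neg_binomial_sums_real[OF assms, of N] neg_binomial_sums_real[of "\<bar>u\<bar>" N] assms
  by (intro norm_summable_imp_has_sum) (auto simp: norm_mult norm_power abs_mult power_abs sums_iff)

lemma neg_binomial_has_sum_complex:
  fixes u :: complex
  assumes "norm u < 1"
  shows "((\<lambda>k. of_nat ((N + k) choose k) * u ^ k) has_sum (1 / (1 - u) ^ Suc N)) UNIV"
  using neg_binomial_sums_complex[OF assms, of N] neg_binomial_sums_real[of "norm u" N] assms
  by (intro norm_summable_imp_has_sum) (auto simp: norm_mult norm_power abs_mult power_abs sums_iff)

definition multinom :: "nat \<Rightarrow> (nat \<Rightarrow> nat) \<Rightarrow> real" where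
  "multinom d q = fact (\<Sum>i<d. q i) / (\<Prod>i<d. fact (q i))"

lemma multinom_nonneg: "multinom d q \<ge> 0"
  by (simp add: multinom_def prod_nonneg)

lemma multinom_Suc:
  "multinom (Suc d) (q(d := n)) = multinom d q * of_nat (((\<Sum>i<d. q i) + n) choose n)"
  by (simp add: multinom_def binomial_fact)

text \<open>Induction on \<open>d\<close>. Summing over the last exponent first is a negative
  binomial series and yields powers of \<open>1 / (1 - x d)\<close>. These are absorbed by rescaling
  the other variables to \<open>x i / (1 - x d)\<close>, whose absolute values again sum to less
  than 1.\<close>

lemma multinomial_has_sum:
  assumes "(\<Sum>i<d. \<bar>x i\<bar>) < 1"
  shows "((\<lambda>q. multinom d q * (\<Prod>i<d. x i ^ q i)) has_sum (1 / (1 - (\<Sum>i<d. x i)))) (exponents d)"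
  using assms
proof (induction d arbitrary: x)
  case 0
  have "exponents 0 = {\<lambda>_. undefined}" by (auto simp: exponents_def)
  then show ?case by (intro has_sum_finiteI) (auto simp: multinom_def)
next
  case (Suc d)
  define f where "f = (\<lambda>x (q, n). multinom d q * of_nat (((\<Sum>i<d. q i) + n) choose n) *
                                  ((\<Prod>i<d. x i ^ q i) * (x d :: real) ^ n))"
  define g where "g = (\<lambda>x q. multinom d q * (\<Prod>i<d. x i ^ q i) * (1 / (1 - x d :: real) ^ Suc (\<Sum>i<d. q i)))"
  have inner: "((\<lambda>n. f x (q, n)) has_sum g x q) UNIV" if "(\<Sum>i<Suc d. \<bar>x i\<bar>) < 1" for x q
  proof -
    have "(\<Sum>i<d. \<bar>x i\<bar>) \<ge> 0" by (intro sum_nonneg) auto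
    with that have "\<bar>x d\<bar> < 1" unfolding sum.lessThan_Suc by linarith
    from has_sum_cmult_right[OF neg_binomial_has_sum_real[OF this, of "\<Sum>i<d. q i"],
        of "multinom d q * (\<Prod>i<d. x i ^ q i)"]
    show ?thesis unfolding f_def g_def prod.case by (simp only: mult_ac)
  qed
  have outer: "(g x has_sum (1 / (1 - (\<Sum>i<Suc d. x i)))) (exponents d)"
    if "(\<Sum>i<Suc d. \<bar>x i\<bar>) < 1" for x
  proof -
    have "(\<Sum>i<d. \<bar>x i\<bar>) \<ge> 0" by (intro sum_nonneg) auto
    with that have xd: "\<bar>x d\<bar> < 1" unfolding sum.lessThan_Suc by linarith
    have "(\<Sum>i<d. \<bar>x i / (1 - x d)\<bar>) = (\<Sum>i<d. \<bar>x i\<bar>) / (1 - x d)"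
      using xd by (simp add: sum_divide_distrib)
    also have "\<dots> < 1" using that xd by (auto simp: divide_less_eq)
    finally have "((\<lambda>q. multinom d q * (\<Prod>i<d. (x i / (1 - x d)) ^ q i)) has_sum
                    (1 / (1 - (\<Sum>i<d. x i / (1 - x d))))) (exponents d)"
      by (rule Suc.IH)
    from has_sum_cmult_left[OF this, of "1 / (1 - x d)"]
    have "((\<lambda>q. multinom d q * (\<Prod>i<d. (x i / (1 - x d)) ^ q i) * (1 / (1 - x d))) has_sum
                    (1 / (1 - (\<Sum>i<d. x i / (1 - x d))) * (1 / (1 - x d)))) (exponents d)" .
    moreover have "(1 - (\<Sum>i<d. x i / (1 - x d))) * (1 - x d) = 1 - (\<Sum>i<Suc d. x i)"
      using xd by (simp add: sum_divide_distrib[symmetric] field_simps)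
    moreover have "multinom d q * (\<Prod>i<d. (x i / (1 - x d)) ^ q i) * (1 / (1 - x d)) = g x q" for q
      by (simp add: g_def power_divide prod_dividef power_sum)
    ultimately show ?thesis by (simp del: sum.lessThan_Suc)
  qed
  \<comment> \<open>The same iterated summation at the absolute values gives absolute convergence,
    which justifies summing over pairs.\<close>
  have "f (\<lambda>i. \<bar>x i\<bar>) summable_on (exponents d \<times> UNIV)"
    by (rule summable_on_SigmaI[OF inner has_sum_imp_summable[OF outer]])
       (use Suc.prems in \<open>auto simp: f_def multinom_nonneg prod_nonneg\<close>)
  moreover have "(\<lambda>p. norm (f x p)) = f (\<lambda>i. \<bar>x i\<bar>)"
    by (auto simp: fun_eq_iff f_def abs_mult multinom_nonneg abs_prod power_abs)
  ultimately have "f x summable_on (exponents d \<times> UNIV)"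
    by (metis abs_summable_summable)
  with inner[OF Suc.prems] outer[OF Suc.prems]
  have "(f x has_sum (1 / (1 - (\<Sum>i<Suc d. x i)))) (exponents d \<times> UNIV)"
    by (rule has_sum_SigmaI)
  then show ?case
    unfolding has_sum_exponents_Suc
    by (simp add: f_def multinom_Suc case_prod_unfold del: sum.lessThan_Suc)
qed

section \<open>Expansion of F and the diagonal coefficients\<close>

definition F_coeff :: "nat \<Rightarrow> real \<Rightarrow> (nat \<Rightarrow> nat) \<Rightarrow> real" where
  "F_coeff d c r = (\<Sum>k | \<forall>i<d. k \<le> r i. multinom (Suc d) ((\<lambda>i. r i - k)(d := k)) * (- c) ^ k)"

text \<open>\<open>F\<close> is the multinomial series in \<open>d + 1\<close> variables, the
  additional one being \<open>- c * e_last d x\<close>. Collecting monomials by their exponents in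
  \<open>x\<close> gives \<open>F_coeff\<close>, where \<open>k\<close> is the exponent of the
  additional variable.\<close>

lemma has_powser_expansion_F:
  assumes "d > 0"
  shows "has_powser_expansion d (F c d) (F_coeff d c)"
  unfolding has_powser_expansion_def
proof (intro exI[of _ "1 / (real d + \<bar>c\<bar> + 1)"] conjI allI impI)
  \<comment> \<open>Chosen so that \<open>\<rho> ^ d \<le> \<rho>\<close> and
    \<open>\<rho> * (d + |c|) < 1\<close>; then the \<open>d + 1\<close> values \<open>y i\<close>
    have absolute sum below 1.\<close>
  define \<rho> where "\<rho> = 1 / (real d + \<bar>c\<bar> + 1)"
  have \<rho>: "\<rho> > 0" "\<rho> \<le> 1" "\<rho> * (real d + \<bar>c\<bar>) < 1"
    by (auto simp: \<rho>_def field_simps)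
  show "1 / (real d + \<bar>c\<bar> + 1) > 0" using \<rho> by (simp add: \<rho>_def)
  fix x :: "nat \<Rightarrow> real" assume "\<forall>i<d. \<bar>x i\<bar> < 1 / (real d + \<bar>c\<bar> + 1)"
  then have x: "\<bar>x i\<bar> < \<rho>" if "i < d" for i using that by (simp add: \<rho>_def)
  define y where "y = x(d := - c * (\<Prod>i<d. x i))"
  define K where "K = (\<lambda>r::nat\<Rightarrow>nat. {k. \<forall>i<d. k \<le> r i})"
  define T where "T = (\<lambda>(r, k). multinom (Suc d) ((\<lambda>i. r i - k)(d := k)) * (- c) ^ k * (\<Prod>i<d. x i ^ r i))"
  have "(\<Sum>i<d. \<bar>x i\<bar>) \<le> (\<Sum>i<d. \<rho>)"
    using x by (intro sum_mono) (auto intro: less_imp_le)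
  moreover have "(\<Prod>i<d. \<bar>x i\<bar>) \<le> (\<Prod>i<d. \<rho>)"
    using x by (intro prod_mono) (auto intro: less_imp_le)
  moreover have "\<rho> ^ d \<le> \<rho>"
    using \<rho> assms power_decreasing[of 1 d \<rho>] by simp
  ultimately have "(\<Sum>i<d. \<bar>x i\<bar>) + \<bar>c\<bar> * (\<Prod>i<d. \<bar>x i\<bar>) \<le> real d * \<rho> + \<bar>c\<bar> * \<rho>"
    by (intro add_mono mult_left_mono) auto
  also have "\<dots> < 1" using \<rho> by (simp add: algebra_simps)
  finally have "(\<Sum>i<Suc d. \<bar>y i\<bar>) < 1"
    by (simp add: y_def abs_mult abs_prod)
  from multinomial_has_sum[OF this]
  have "((\<lambda>q. multinom (Suc d) q * (\<Prod>i<Suc d. y i ^ q i)) has_sum F c d x) (exponents (Suc d))"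
    by (simp add: y_def F_def e_first_def e_last_def algebra_simps)
  also have "?this \<longleftrightarrow> (T has_sum F c d x) (SIGMA r:exponents d. K r)"
  \<comment> \<open>Each power of the additional variable contributes every \<open>x i\<close> once,
    so the exponent of \<open>x i\<close> is \<open>q i + q d\<close>.\<close>
  proof (rule has_sum_reindex_bij_witness[where
        i = "\<lambda>(r, k) i. if i < d then r i - k else if i = d then k else undefined" and
        j = "\<lambda>q. (\<lambda>i. if i < d then q i + q d else undefined, q d)"])
    fix q assume q: "q \<in> exponents (Suc d)"
    show "T (\<lambda>i. if i < d then q i + q d else undefined, q d) =
            multinom (Suc d) q * (\<Prod>i<Suc d. y i ^ q i)"
      by (simp add: T_def y_def multinom_def power_add prod.distrib power_mult_distrib
            prod_power_distrib power_minus')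
  qed (auto simp: exponents_def PiE_def extensional_def fun_eq_iff K_def less_Suc_eq)
  finally have T: "(T has_sum F c d x) (SIGMA r:exponents d. K r)" .
  show "((\<lambda>r. F_coeff d c r * (\<Prod>i<d. x i ^ r i)) has_sum F c d x) (exponents d)"
  proof (rule has_sum_SigmaD[OF T])
    fix r :: "nat \<Rightarrow> nat"
    have "K r \<subseteq> {..r 0}" using assms by (auto simp: K_def)
    then have "finite (K r)" by (rule finite_subset) simp
    then show "((\<lambda>k. T (r, k)) has_sum (F_coeff d c r * (\<Prod>i<d. x i ^ r i))) (K r)"
      by (intro has_sum_finiteI) (auto simp: T_def F_coeff_def K_def sum_distrib_right)
  qed
qed

lemma delta_eq:
  assumes "d > 0"
  shows "delta d c n = (\<Sum>j\<le>n. (fact (d * j) / fact j ^ d) * (of_nat ((d * j + (n - j)) choose (n - j)) * (- c) ^ (n - j)))"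
proof -
  have "(\<lambda>i\<in>{..<d}. n) \<in> exponents d" by (simp add: exponents_def)
  from powser_coeff_eqI[OF has_powser_expansion_F[OF assms] this]
  have "delta d c n = F_coeff d c (\<lambda>i\<in>{..<d}. n)" by (simp add: delta_def)
  also have "\<dots> = (\<Sum>k\<le>n. multinom (Suc d) ((\<lambda>i. (if i < d then n else undefined) - k)(d := k)) * (- c) ^ k)"
  proof -
    have "{k. \<forall>i<d. k \<le> n} = {..n}" using assms by auto
    then show ?thesis by (simp add: F_coeff_def restrict_def cong: conj_cong)
  qed
  also have "\<dots> = (\<Sum>k\<le>n. (fact (d * (n - k)) / fact (n - k) ^ d) * (of_nat ((d * (n - k) + k) choose k) * (- c) ^ k))"
    by (intro sum.cong refl) (simp add: multinom_Suc, simp add: multinom_def)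
  also have "\<dots> = (\<Sum>j\<le>n. (fact (d * j) / fact j ^ d) * (of_nat ((d * j + (n - j)) choose (n - j)) * (- c) ^ (n - j)))"
    by (rule sum.reindex_bij_witness[of _ "\<lambda>j. n - j" "\<lambda>k. n - k"]) auto
  finally show ?thesis .
qed

section \<open>The diagonal series\<close>

text \<open>For \<open>j \<le> n\<close> this is the coefficient of \<open>t ^ n\<close> in
  \<open>t ^ j / (1 + c t) ^ (d j + 1)\<close>, the weight of the \<open>j\<close>-th multinomial
  coefficient in \<open>delta d c n\<close>.\<close>

definition tail_coeff :: "nat \<Rightarrow> real \<Rightarrow> nat \<Rightarrow> nat \<Rightarrow> real" where
  "tail_coeff d c n j = of_nat ((d * j + (n - j)) choose (n - j)) * (- c) ^ (n - j)"

text \<open>Each \<open>B j * t ^ j / (1 + c t) ^ (d j + 1)\<close> is expanded by the negative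
  binomial series, and the double series is rearranged by total degree \<open>n = j + k\<close>.
  \<open>B\<close> stays general because it stands both for the multinomial coefficients and for the
  powers of a point of the interval carrying their moment measure.\<close>

lemma tail_coeff_sums:
  fixes t h :: complex
  assumes B: "\<And>j. \<bar>B j\<bar> \<le> X ^ j" and X: "X \<ge> 0"
    and t: "\<bar>c\<bar> * norm t < 1" "X * norm t < (1 - \<bar>c\<bar> * norm t) ^ d"
    and h: "(\<lambda>j. of_real (B j) * (t / (1 + of_real c * t) ^ d) ^ j) sums h"
  shows "(\<lambda>n. of_real (\<Sum>j\<le>n. B j * tail_coeff d c n j) * t ^ n) sums (h / (1 + of_real c * t))"
proof -
  \<comment> \<open>\<open>s\<close> bounds \<open>norm (1 + c t)\<close> from below and also
    replaces \<open>1 + c t\<close> in the series of absolute values, which is thus dominated by a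
    geometric series of ratio \<open>X * norm t / s ^ d\<close>.\<close>
  define s where "s = 1 - \<bar>c\<bar> * norm t"
  have s: "s > 0" "X * norm t < s ^ d" using t by (auto simp: s_def)
  have s1: "s \<le> norm (1 + of_real c * t)"
    using norm_triangle_ineq2[of 1 "- (of_real c * t)"] by (simp add: s_def norm_mult)
  then have s2: "norm (1 + of_real c * t) > 0" using s by linarith
  have geo: "X * norm t / s ^ d < 1" "X * norm t / s ^ d \<ge> 0" using s X by auto
  define f where "f = (\<lambda>(j, k). of_real (B j) * t ^ j * (of_nat ((d * j + k) choose k) * (- of_real c * t) ^ k))"
  define z where "z = t / (1 + of_real c * t) ^ d"
  have inner: "((\<lambda>k. f (j, k)) has_sum (of_real (B j) * z ^ j / (1 + of_real c * t))) UNIV" for j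
  proof -
    have "norm (- of_real c * t) < 1" using t by (simp add: norm_mult)
    from has_sum_cmult_right[OF neg_binomial_has_sum_complex[OF this, of "d * j"], of "of_real (B j) * t ^ j"]
    have "((\<lambda>k. f (j, k)) has_sum
        of_real (B j) * t ^ j * (1 / (1 - - of_real c * t) ^ Suc (d * j))) UNIV"
      by (simp add: f_def)
    also have "of_real (B j) * t ^ j * (1 / (1 - - of_real c * t) ^ Suc (d * j)) =
        of_real (B j) * z ^ j / (1 + of_real c * t)"
      by (simp add: z_def power_divide power_mult)
    finally show ?thesis .
  qed
  have "(\<lambda>j. norm (of_real (B j) * z ^ j)) summable_on UNIV"
  proof (rule Infinite_Sum.abs_summable_on_comparison_test'[OF summable_nonneg_imp_summable_on[OF summable_geometric]])
    fix j :: nat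
    have "norm z \<le> norm t / s ^ d"
      using s s1 s2 by (auto simp: z_def norm_divide norm_power intro!: divide_left_mono power_mono mult_pos_pos)
    then have "norm (of_real (B j) * z ^ j) \<le> X ^ j * (norm t / s ^ d) ^ j"
      unfolding norm_mult norm_power using B[of j] X by (intro mult_mono power_mono) auto
    then show "norm (of_real (B j) * z ^ j) \<le> (X * norm t / s ^ d) ^ j"
      by (simp add: power_mult_distrib power_divide)
  qed (use geo X in \<open>auto simp: abs_mult\<close>)
  then have "((\<lambda>j. of_real (B j) * z ^ j) has_sum h) UNIV"
    using h unfolding z_def
    by (intro norm_summable_imp_has_sum) (auto intro: summable_on_imp_summable)
  from has_sum_divide_const[OF this, of "1 + of_real c * t"]
  have outer: "((\<lambda>j. of_real (B j) * z ^ j / (1 + of_real c * t)) has_sum (h / (1 + of_real c * t))) UNIV" .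
  have "(\<lambda>p. norm (f p)) summable_on (UNIV \<times> UNIV)"
  proof (rule summable_on_SigmaI)
    fix j :: nat
    have "\<bar>\<bar>c\<bar> * norm t\<bar> < 1" using t by simp
    from has_sum_cmult_right[OF neg_binomial_has_sum_real[OF this, of "d * j"], of "\<bar>B j\<bar> * norm t ^ j"]
    show "((\<lambda>k. norm (f (j, k))) has_sum (\<bar>B j\<bar> * norm t ^ j * (1 / s ^ Suc (d * j)))) UNIV"
      by (simp add: f_def norm_mult norm_power power_mult_distrib s_def mult_ac)
  next
    have "(\<lambda>j. norm (\<bar>B j\<bar> * norm t ^ j * (1 / s ^ Suc (d * j)))) summable_on UNIV"
    proof (rule Infinite_Sum.abs_summable_on_comparison_test'[OF summable_nonneg_imp_summable_on[OF
            summable_mult[OF summable_geometric]]])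
      fix j :: nat
      have "\<bar>B j\<bar> * norm t ^ j * (1 / s ^ Suc (d * j)) \<le> X ^ j * norm t ^ j * (1 / s ^ Suc (d * j))"
        using B[of j] s by (intro mult_right_mono) auto
      then show "norm (\<bar>B j\<bar> * norm t ^ j * (1 / s ^ Suc (d * j))) \<le> (1 / s) * (X * norm t / s ^ d) ^ j"
        using s by (simp add: abs_mult power_mult_distrib power_divide power_mult)
    qed (use geo s X in \<open>auto simp: abs_mult\<close>)
    then show "(\<lambda>j. \<bar>B j\<bar> * norm t ^ j * (1 / s ^ Suc (d * j))) summable_on UNIV"
      by (rule abs_summable_summable)
  qed auto
  then have "f summable_on (UNIV \<times> UNIV)"
    by (rule abs_summable_summable)
  with inner outer have "(f has_sum (h / (1 + of_real c * t))) (UNIV \<times> UNIV)"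
    by (rule has_sum_SigmaI)
  also have "?this \<longleftrightarrow> ((\<lambda>(n, j). of_real (B j * tail_coeff d c n j) * t ^ n) has_sum
                (h / (1 + of_real c * t))) (SIGMA n:UNIV. {..n})"
    by (rule has_sum_reindex_bij_witness[where i = "\<lambda>(n, j). (j, n - j)" and j = "\<lambda>(j, k). (j + k, j)"])
       (auto simp: f_def tail_coeff_def power_add power_mult_distrib power_minus')
  finally have "((\<lambda>n. \<Sum>j\<le>n. of_real (B j * tail_coeff d c n j) * t ^ n) has_sum
                (h / (1 + of_real c * t))) UNIV"
    by (rule has_sum_SigmaD) (auto intro: has_sum_finiteI)
  then show ?thesis
    by (intro has_sum_imp_sums) (simp add: sum_distrib_right)
qed

section \<open>Size and moments of the multinomial coefficients\<close>

lemma fact_add_eq_prod: "fact (m + k) = fact m * (\<Prod>i=1..k. (of_nat (m + i) :: 'a::field_char_0))"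
  by (induction k) (auto simp: algebra_simps)

text \<open>Gauss's multiplication formula at integers: raising \<open>j\<close> by one adds the
  \<open>d\<close> factors \<open>d j + i = d * (i / d + j)\<close>.\<close>

lemma fact_mult_eq_pochhammer:
  assumes "d > 0"
  shows "fact (d * j) = real d ^ (d * j) * (\<Prod>i=1..d. pochhammer (real i / real d) j)"
proof (induction j)
  case (Suc j)
  have "fact (d * Suc j) = fact (d * j) * (\<Prod>i=1..d. real (d * j + i))"
    using fact_add_eq_prod[of "d * j" d] by (simp add: add.commute)
  also have "(\<Prod>i=1..d. real (d * j + i)) = (\<Prod>i=1..d. real d * (real i / real d + real j))"
    using assms by (intro prod.cong) (auto simp: field_simps)
  also have "\<dots> = real d ^ d * (\<Prod>i=1..d. real i / real d + real j)"
    by (simp add: prod.distrib)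
  finally show ?case
    by (simp add: Suc.IH pochhammer_Suc prod.distrib power_add mult_ac)
qed simp

text \<open>The factor \<open>i = d\<close> is \<open>pochhammer 1 j = fact j\<close> and cancels
  one factor of the denominator. Each remaining ratio is a moment of a Beta distribution.\<close>

lemma multinomial_eq_pochhammer:
  assumes "d > 0"
  shows "fact (d * j) / fact j ^ d =
           real d ^ (d * j) * (\<Prod>i=1..<d. pochhammer (real i / real d) j / fact j)"
proof -
  have "{1..d} = insert d {1..<d}" using assms by auto
  then have "(\<Prod>i=1..d. pochhammer (real i / real d) j) = fact j * (\<Prod>i=1..<d. pochhammer (real i / real d) j)"
    using assms by (simp add: pochhammer_fact)
  moreover have "fact j ^ d = fact j * (fact j :: real) ^ (d - 1)"
    using assms by (cases d) auto
  ultimately show ?thesis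
    by (simp add: fact_mult_eq_pochhammer[OF assms] prod_dividef)
qed

lemma pochhammer_mono:
  fixes a b :: real
  assumes "0 \<le> a" "a \<le> b"
  shows "pochhammer a n \<le> pochhammer b n"
  unfolding pochhammer_prod using assms by (intro prod_mono) auto

lemma multinomial_le:
  assumes "d > 0"
  shows "fact (d * j) / fact j ^ d \<le> real d ^ (d * j)"
proof -
  have "(\<Prod>i=1..<d. pochhammer (real i / real d) j / fact j) \<le> (\<Prod>i=1..<d. 1)"
    using pochhammer_mono[of _ 1 j]
    by (intro prod_mono) (auto simp: pochhammer_fact[symmetric] intro!: divide_nonneg_nonneg pochhammer_nonneg)
  then show ?thesis
    unfolding multinomial_eq_pochhammer[OF assms] by (simp add: mult_left_le)
qed

text \<open>Splitting off the first factor, \<open>pochhammer a j\<close> is at least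
  \<open>a * fact (j - 1)\<close>; for \<open>a \<ge> 1 / d\<close> each ratio is therefore at least
  \<open>1 / (d j)\<close>.\<close>

lemma multinomial_ge:
  assumes "d > 0" "j > 0"
  shows "fact (d * j) / fact j ^ d \<ge> real d ^ (d * j) * (1 / (real d * real j)) ^ (d - 1)"
proof -
  have "1 / (real d * real j) \<le> pochhammer (real i / real d) j / fact j" if "i \<in> {1..<d}" for i
  proof -
    obtain k where k: "j = Suc k" using assms(2) by (cases j) auto
    have "1 / real d * fact k \<le> real i / real d * pochhammer (real i / real d + 1) k"
      using that pochhammer_mono[of 1 "real i / real d + 1" k]
      by (intro mult_mono) (auto simp: pochhammer_fact[symmetric] divide_right_mono)
    then have "1 / real d * fact k / fact (Suc k) \<le> pochhammer (real i / real d) j / fact j"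
      unfolding k pochhammer_rec by (intro divide_right_mono) auto
    moreover have "1 / real d * fact k / fact (Suc k) = 1 / (real d * real j)"
      by (simp add: k divide_simps)
    ultimately show ?thesis by metis
  qed
  then have "(\<Prod>i=1..<d. 1 / (real d * real j)) \<le> (\<Prod>i=1..<d. pochhammer (real i / real d) j / fact j)"
    by (intro prod_mono) auto
  then show ?thesis
    unfolding multinomial_eq_pochhammer[OF assms(1)] by (simp add: mult_left_mono)
qed

text \<open>The moments of the Beta distribution with parameters \<open>a\<close> and
  \<open>1 - a\<close>, from \<open>Gamma (a + j) = pochhammer a j * Gamma a\<close> and
  \<open>Gamma (1 + j) = fact j\<close>.\<close>

lemma Beta_add_of_nat:
  fixes a :: real
  assumes "0 < a" "a < 1"
  shows "Beta (a + of_nat j) (1 - a) = Beta a (1 - a) * (pochhammer a j / fact j)"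
proof -
  have a: "a \<notin> \<int>\<^sub>\<le>\<^sub>0" using assms(1) by (auto elim!: nonpos_Ints_cases')
  then have "Gamma a \<noteq> 0" by (simp add: Gamma_eq_zero_iff)
  with pochhammer_Gamma[OF a, of j] have "Gamma (a + of_nat j) = pochhammer a j * Gamma a" by simp
  moreover have "Gamma (1 + real j) = fact j" by (rule Gamma_fact)
  ultimately show ?thesis by (simp add: Beta_def add_ac)
qed

text \<open>As \<open>pochhammer a j / fact j\<close> is the \<open>j\<close>-th moment of a Beta
  distribution on \<open>{0..1}\<close>, the new sum is the mean over \<open>t\<close> of the old
  polynomial at \<open>x * t\<close>. These points stay in \<open>{0..X}\<close>, so the bound
  survives.\<close>

lemma poly_pochhammer_bound:
  fixes p :: "nat \<Rightarrow> real"
  assumes a: "0 < a" "a < 1" and x: "x \<in> {0..X}"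
    and M: "\<And>x. x \<in> {0..X} \<Longrightarrow> \<bar>\<Sum>j\<le>n. p j * x ^ j\<bar> \<le> M"
  shows "\<bar>\<Sum>j\<le>n. p j * (pochhammer a j / fact j) * x ^ j\<bar> \<le> M"
proof -
  define w where "w = (\<lambda>t::real. t powr (a - 1) * (1 - t) powr (1 - a - 1))"
  define I where "I = Beta a (1 - a)"
  have w: "((\<lambda>t. t ^ j * w t) has_integral (I * (pochhammer a j / fact j))) {0..1}" for j
  proof -
    have "((\<lambda>t. t powr (a + of_nat j - 1) * (1 - t) powr (1 - a - 1)) has_integral Beta (a + of_nat j) (1 - a)) {0..1}"
      using a by (intro has_integral_Beta_real) auto
    moreover have "t powr (a + of_nat j - 1) * (1 - t) powr (1 - a - 1) = t ^ j * w t" if "t \<in> {0..1}" for t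
    \<comment> \<open>At \<open>t = 0\<close> both sides are 0, also for \<open>j = 0\<close>,
      because \<open>powr\<close> is 0 at base 0.\<close>
    proof (cases "t = 0")
      case False
      then have "t powr (a + of_nat j - 1) = t powr (a - 1) * t ^ j"
        using that powr_add[of t "a - 1" "of_nat j"] by (simp add: powr_realpow algebra_simps)
      then show ?thesis by (simp add: w_def)
    qed (simp add: w_def)
    ultimately show ?thesis
      using has_integral_cong[of "{0..1}"] Beta_add_of_nat[OF a, of j] unfolding I_def
      by (smt (verit) has_integral_eq)
  qed
  have w0: "(w has_integral I) {0..1}" using w[of 0] by simp
  have "I > 0" using a unfolding I_def Beta_def by (intro divide_pos_pos mult_pos_pos Gamma_real_pos) auto
  have w_nonneg: "w t \<ge> 0" for t by (simp add: w_def)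
  define S where "S = (\<Sum>j\<le>n. p j * (pochhammer a j / fact j) * x ^ j)"
  have "((\<lambda>t. \<Sum>j\<le>n. (p j * x ^ j) * (t ^ j * w t)) has_integral (\<Sum>j\<le>n. (p j * x ^ j) * (I * (pochhammer a j / fact j)))) {0..1}"
    by (intro has_integral_sum has_integral_mult_right w) auto
  also have "(\<lambda>t. \<Sum>j\<le>n. (p j * x ^ j) * (t ^ j * w t)) = (\<lambda>t. (\<Sum>j\<le>n. p j * (x * t) ^ j) * w t)"
    by (simp add: sum_distrib_left power_mult_distrib mult_ac)
  also have "(\<Sum>j\<le>n. (p j * x ^ j) * (I * (pochhammer a j / fact j))) = S * I"
    by (simp add: S_def sum_distrib_left mult_ac)
  finally have S: "((\<lambda>t. (\<Sum>j\<le>n. p j * (x * t) ^ j) * w t) has_integral S * I) {0..1}" .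
  have bd: "\<bar>\<Sum>j\<le>n. p j * (x * t) ^ j\<bar> \<le> M" if "t \<in> {0..1}" for t
    using x that by (intro M) (auto intro: mult_le_one mult_left_le order_trans)
  have "S * I \<le> M * I"
    by (rule has_integral_le[OF S has_integral_mult_right[OF w0]])
       (use bd w_nonneg in \<open>auto intro!: mult_right_mono simp: abs_le_iff\<close>)
  moreover have "(- M) * I \<le> S * I"
    by (rule has_integral_le[OF has_integral_mult_right[OF w0] S])
       (use bd w_nonneg in \<open>intro mult_right_mono; fastforce simp: abs_le_iff\<close>)
  ultimately have "S \<le> M" "- M \<le> S"
    using \<open>I > 0\<close> mult_right_le_imp_le by blast+
  then show ?thesis unfolding S_def[symmetric] by (simp add: abs_le_iff)
qed

text \<open>
  The multinomial coefficients are the moments of a probability measure on \<open>{0..d ^ d}\<close>, a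
  multiplicative convolution of Beta distributions.
\<close>

lemma sum_multinomial_bound:
  fixes p :: "nat \<Rightarrow> real"
  assumes "d > 0"
    and M: "\<And>x. x \<in> {0..real d ^ d} \<Longrightarrow> \<bar>\<Sum>j\<le>n. p j * x ^ j\<bar> \<le> M"
  shows "\<bar>\<Sum>j\<le>n. p j * (fact (d * j) / fact j ^ d)\<bar> \<le> M"
proof -
  \<comment> \<open>The ratios are inserted one after another. The bound is carried along for all
    \<open>x\<close> in the interval, since the next insertion averages over it.\<close>
  have "\<bar>\<Sum>j\<le>n. p j * (\<Prod>i=1..<m. pochhammer (real i / real d) j / fact j) * x ^ j\<bar> \<le> M"
    if "1 \<le> m" "m \<le> d" "x \<in> {0..real d ^ d}" for m x
    using that
  proof (induction m arbitrary: x rule: dec_induct)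
    case base
    then show ?case using M by simp
  next
    case (step m)
    have "\<bar>\<Sum>j\<le>n. (p j * (\<Prod>i=1..<m. pochhammer (real i / real d) j / fact j)) *
             (pochhammer (real m / real d) j / fact j) * x ^ j\<bar> \<le> M"
      by (rule poly_pochhammer_bound[where X = "real d ^ d"]) (use step in auto)
    then show ?case using step.hyps by (simp add: mult.assoc prod.atLeastLessThan_Suc)
  qed
  \<comment> \<open>At the right endpoint \<open>x ^ j\<close> is the missing factor
    \<open>real d ^ (d * j)\<close>.\<close>
  from this[of d "real d ^ d"] assms(1)
  have "\<bar>\<Sum>j\<le>n. p j * (\<Prod>i=1..<d. pochhammer (real i / real d) j / fact j) * (real d ^ d) ^ j\<bar> \<le> M"
    by simp
  moreover have "p j * (\<Prod>i=1..<d. pochhammer (real i / real d) j / fact j) * (real d ^ d) ^ j =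
               p j * (fact (d * j) / fact j ^ d)" for j
    unfolding multinomial_eq_pochhammer[OF assms(1)] by (simp add: power_mult)
  ultimately show ?thesis by simp
qed

section \<open>The argument of the multinomial series near the origin\<close>

lemma small_disc:
  fixes c X :: real
  obtains \<rho> where "\<rho> > 0"
    "\<And>u. 0 \<le> u \<Longrightarrow> u < \<rho> \<Longrightarrow> \<bar>c\<bar> * u < 1"
    "\<And>u. 0 \<le> u \<Longrightarrow> u < \<rho> \<Longrightarrow> X * u < (1 - \<bar>c\<bar> * u) ^ d"
proof -
  have "((\<lambda>u. 1 - \<bar>c\<bar> * u) \<longlongrightarrow> 1 - \<bar>c\<bar> * 0) (nhds (0::real))"
    by (intro tendsto_intros filterlim_ident)
  then have 1: "eventually (\<lambda>u. 1 - \<bar>c\<bar> * u > 0) (nhds 0)"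
    by (rule order_tendstoD) simp
  have "((\<lambda>u. (1 - \<bar>c\<bar> * u) ^ d - X * u) \<longlongrightarrow> (1 - \<bar>c\<bar> * 0) ^ d - X * 0) (nhds (0::real))"
    by (intro tendsto_intros filterlim_ident)
  then have 2: "eventually (\<lambda>u. (1 - \<bar>c\<bar> * u) ^ d - X * u > 0) (nhds 0)"
    by (rule order_tendstoD) simp
  from eventually_conj[OF 1 2] obtain \<rho> where "\<rho> > 0"
    "\<And>u. dist u 0 < \<rho> \<Longrightarrow> 1 - \<bar>c\<bar> * u > 0 \<and> (1 - \<bar>c\<bar> * u) ^ d - X * u > 0"
    unfolding eventually_nhds_metric by blast
  then show thesis by (intro that[of \<rho>]) (auto simp: dist_real_def)
qed

definition diag_map :: "nat \<Rightarrow> real \<Rightarrow> complex \<Rightarrow> complex" where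
  "diag_map d c t = t / (1 + of_real c * t) ^ d"

lemma one_plus_nonzero:
  fixes t :: complex
  assumes "\<bar>c\<bar> * norm t < 1"
  shows "1 + of_real c * t \<noteq> 0"
proof
  assume "1 + of_real c * t = 0"
  then have "of_real c * t = -1" by (simp add: eq_neg_iff_add_eq_0 add.commute)
  then have "norm (of_real c * t) = 1" by simp
  then show False using assms by (simp add: norm_mult)
qed

lemma norm_diag_map_less:
  assumes "d > 0" "\<bar>c\<bar> * norm t < 1" "real d ^ d * norm t < (1 - \<bar>c\<bar> * norm t) ^ d"
  shows "norm (diag_map d c t) < 1 / real d ^ d"
proof -
  have le: "1 - \<bar>c\<bar> * norm t \<le> norm (1 + of_real c * t)"
    using norm_triangle_ineq2[of 1 "- (of_real c * t)"] by (simp add: norm_mult)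
  have "real d ^ d * norm t < (1 - \<bar>c\<bar> * norm t) ^ d" by fact
  also have "\<dots> \<le> norm (1 + of_real c * t) ^ d" using le assms(2) by (intro power_mono) auto
  finally show ?thesis
    using one_plus_nonzero[OF assms(2)] assms(1)
    by (simp add: diag_map_def norm_divide norm_power divide_simps mult_ac)
qed

section \<open>Upper bound for the growth rate\<close>

lemma abs_sin_mult_le: "\<bar>sin (real n * x)\<bar> \<le> real n * \<bar>sin x\<bar>"
proof (induction n)
  case (Suc n)
  have "\<bar>sin (real (Suc n) * x)\<bar> \<le> \<bar>sin (real n * x) * cos x\<bar> + \<bar>cos (real n * x) * sin x\<bar>"
    by (simp add: algebra_simps sin_add abs_triangle_ineq)
  also have "\<dots> \<le> \<bar>sin (real n * x)\<bar> * 1 + 1 * \<bar>sin x\<bar>"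
    unfolding abs_mult by (intro add_mono mult_mono) auto
  also have "\<dots> \<le> real (Suc n) * \<bar>sin x\<bar>" using Suc by (simp add: algebra_simps)
  finally show ?case .
qed simp

text \<open>For \<open>x > 0\<close> and \<open>s\<close> the \<open>d\<close>-th root of
  \<open>x\<close>, a zero gives \<open>\<tau>\<close> with \<open>\<tau> ^ d = t\<close> and
  \<open>1 + c t = s \<tau>\<close>. Eliminating \<open>s\<close> from real and imaginary parts
  leaves \<open>sin \<phi> = c * norm t * sin ((d - 1) * \<phi>)\<close> for the argument
  \<open>\<phi>\<close> of \<open>\<tau>\<close>. As
  \<open>|sin (m \<phi>)| \<le> m * |sin \<phi>|\<close>, hypothesis \<open>R\<close> forces
  \<open>\<tau>\<close> to be real. A nonnegative \<open>\<tau>\<close> contradicts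
  \<open>conv\<close>, a negative one contradicts \<open>c * norm t < 1\<close>.\<close>

lemma denominator_nonzero:
  fixes t :: complex
  assumes d: "d \<ge> 2" and c: "c > 0" and x: "0 \<le> x" "x \<le> real d ^ d"
    and R: "c * norm t * (real d - 1) < 1"
    and conv: "real d ^ d * norm t < (1 + c * norm t) ^ d"
  shows "(1 + of_real c * t) ^ d \<noteq> of_real x * t"
proof
  assume eq: "(1 + of_real c * t) ^ d = of_real x * t"
  have ct: "c * norm t < 1"
  proof -
    have "c * norm t * 1 \<le> c * norm t * (real d - 1)"
      using d c by (intro mult_left_mono) auto
    then show ?thesis using R by simp
  qed
  show False
  proof (cases "x = 0")
    case True
    then have "1 + of_real c * t = 0" using eq d by simp
    then have "of_real c * t = -1" by (simp add: eq_neg_iff_add_eq_0 add.commute)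
    then have "norm (of_real c * t) = 1" by simp
    then show False using ct c by (simp add: norm_mult)
  next
    case False
    define s where "s = root d x"
    have s: "s > 0" "s ^ d = x" using False x d by (auto simp: s_def)
    have "s \<le> root d (real d ^ d)" unfolding s_def using x d by (intro real_root_le_mono) auto
    then have sd: "s \<le> real d" using d by (simp add: real_root_power_cancel)
    define \<tau> where "\<tau> = (1 + of_real c * t) / of_real s"
    have \<tau>: "\<tau> ^ d = t" "1 + of_real c * t = of_real s * \<tau>"
      using s eq False by (simp_all add: \<tau>_def power_divide flip: of_real_power)
    define \<rho> \<phi> where "\<rho> = norm \<tau>" and "\<phi> = Arg \<tau>"
    have rcis: "\<tau> = rcis \<rho> \<phi>" by (simp add: \<rho>_def \<phi>_def rcis_cmod_Arg)
    have \<rho>d: "\<rho> ^ d = norm t" using \<tau>(1) by (simp add: \<rho>_def flip: norm_power)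
    have t: "t = rcis (\<rho> ^ d) (real d * \<phi>)" using \<tau>(1) by (simp add: rcis DeMoivre2)
    have Re_t: "Re t = norm t * cos (real d * \<phi>)" and Im_t: "Im t = norm t * sin (real d * \<phi>)"
      using arg_cong[OF t, of Re] arg_cong[OF t, of Im] unfolding Re_rcis Im_rcis \<rho>d .
    have Re_\<tau>: "Re \<tau> = \<rho> * cos \<phi>" and Im_\<tau>: "Im \<tau> = \<rho> * sin \<phi>"
      using arg_cong[OF rcis, of Re] arg_cong[OF rcis, of Im] unfolding Re_rcis Im_rcis .
    have re: "1 + c * norm t * cos (real d * \<phi>) = s * \<rho> * cos \<phi>"
      using arg_cong[OF \<tau>(2), of Re] Re_t Re_\<tau> by (simp add: mult.assoc)
    have im: "c * norm t * sin (real d * \<phi>) = s * \<rho> * sin \<phi>"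
      using arg_cong[OF \<tau>(2), of Im] Im_t Im_\<tau> by (simp add: mult.assoc)
    have sin_diff': "sin ((real d - 1) * \<phi>) = sin (real d * \<phi>) * cos \<phi> - cos (real d * \<phi>) * sin \<phi>"
      by (simp add: left_diff_distrib sin_diff)
    then have "c * norm t * sin ((real d - 1) * \<phi>) =
        (c * norm t * sin (real d * \<phi>)) * cos \<phi> - (c * norm t * cos (real d * \<phi>)) * sin \<phi>"
      unfolding sin_diff' by (simp only: right_diff_distrib mult_ac)
    also have "c * norm t * cos (real d * \<phi>) = s * \<rho> * cos \<phi> - 1" using re by linarith
    finally have key: "sin \<phi> = c * norm t * sin ((real d - 1) * \<phi>)"
      unfolding im by (simp add: algebra_simps)
    show False
    proof (cases "sin \<phi> = 0")
      case False
      have "\<bar>sin \<phi>\<bar> = c * norm t * \<bar>sin (real (d - 1) * \<phi>)\<bar>"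
        using arg_cong[OF key, of abs] c d by (simp add: abs_mult of_nat_diff)
      also have "\<dots> \<le> c * norm t * (real (d - 1) * \<bar>sin \<phi>\<bar>)"
        using c by (intro mult_left_mono abs_sin_mult_le) auto
      also have "\<dots> = (c * norm t * (real d - 1)) * \<bar>sin \<phi>\<bar>" using d by (simp add: of_nat_diff)
      also have "\<dots> < 1 * \<bar>sin \<phi>\<bar>" using R False by (intro mult_strict_right_mono) auto
      finally show False by simp
    next
      case True
      then have "cos \<phi> = 1 \<or> cos \<phi> = -1" using sin_zero_abs_cos_one[of \<phi>] by linarith
      then show False
      proof
        assume cos: "cos \<phi> = 1"
        then have "\<tau> = of_real \<rho>" using True Re_\<tau> Im_\<tau> by (simp add: complex_eq_iff)
        then have "t = of_real (\<rho> ^ d)" using \<tau>(1) by simp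
        then have "t = of_real (norm t)" unfolding \<rho>d .
        then have "1 + of_real c * of_real (norm t) = of_real s * (of_real \<rho> :: complex)"
          using \<tau>(2) \<open>\<tau> = of_real \<rho>\<close> by metis
        then have "of_real (1 + c * norm t) = (of_real (s * \<rho>) :: complex)"
          by simp
        then have "1 + c * norm t = s * \<rho>" by (simp only: of_real_eq_iff)
        also have "\<dots> \<le> real d * \<rho>" using sd by (intro mult_right_mono) (auto simp: \<rho>_def)
        finally have "(1 + c * norm t) ^ d \<le> (real d * \<rho>) ^ d" using c by (intro power_mono) auto
        then show False using conv \<rho>d by (simp add: power_mult_distrib)
      next
        assume cos: "cos \<phi> = -1"
        have "c * norm t * (-1) \<le> c * norm t * cos (real d * \<phi>)" using c by (intro mult_left_mono) auto
        moreover have "s * \<rho> * cos \<phi> \<le> 0" using s cos by (simp add: \<rho>_def)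
        ultimately show False using re ct by linarith
      qed
    qed
  qed
qed

text \<open>Bernoulli's inequality with a quadratic remainder: there is equality at
  \<open>d = 2\<close>, and passing from \<open>n\<close> to \<open>n + 1\<close> adds
  \<open>(1 - y) * (1 - y ^ n)\<close> to the left side.\<close>

lemma power_tangent_gap:
  fixes y :: real
  assumes "d \<ge> 2" "0 \<le> y" "y \<le> 1"
  shows "y ^ d + real d - 1 - real d * y \<ge> (1 - y) ^ 2"
  using assms(1)
proof (induction d rule: dec_induct)
  case base
  then show ?case by (simp add: power2_eq_square algebra_simps)
next
  case (step n)
  have "(1 - y) * (1 - y ^ n) \<ge> 0" using assms by (intro mult_nonneg_nonneg) (auto simp: power_le_one)
  with step.IH show ?case by (simp add: algebra_simps)
qed

text \<open>The Cauchy inequality is applied on the disc of radius \<open>(Y / (d - 1)) ^ d\<close>,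
  where \<open>k1\<close> and \<open>k2\<close> keep all denominators away from zero. For fixed
  \<open>Y < 1\<close> both hold strictly at \<open>c = (d - 1) ^ (d - 1)\<close>, hence also near
  it.\<close>

lemma delta_upper:
  fixes c Y :: real
  assumes d: "d \<ge> 2" and c: "c > 0" and Y: "0 < Y" "Y < 1"
    and k1: "(real d - 1) ^ (d - 1) * (1 - (1 - Y)^2) < c"
    and k2: "c * Y ^ d < (real d - 1) ^ (d - 1)"
  obtains M where "\<And>n. \<bar>delta d c n\<bar> \<le> M * ((real d - 1) / Y) ^ (d * n)"
proof -
  define e where "e = real d - 1"
  have e: "e \<ge> 1" using d by (simp add: e_def)
  have ed: "e ^ d = e * e ^ (d - 1)" using d by (cases d) auto
  define R where "R = (Y / e) ^ d"
  have R: "R > 0" using Y e by (simp add: R_def)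
  have nz: "(1 + of_real c * t) ^ d \<noteq> of_real x * t" if "x \<in> {0..real d ^ d}" "norm t \<le> R" for x and t :: complex
  proof (rule denominator_nonzero[OF d c])
    have "c * R * e < 1"
      using k2 e by (simp add: R_def power_divide ed e_def[symmetric] field_simps)
    moreover have "c * norm t * e \<le> c * R * e" using that c e by (intro mult_right_mono mult_left_mono) auto
    ultimately show "c * norm t * (real d - 1) < 1" by (simp add: e_def)
    \<comment> \<open>Normalised so that \<open>y = 1\<close> corresponds to
      \<open>norm t = 1 / (d - 1) ^ d\<close>, the critical point for the critical \<open>c\<close>.
      As \<open>y \<le> Y < 1\<close>, the gap in the tangent inequality leaves room for
      \<open>c\<close> slightly below the critical value.\<close>
    define y where "y = e * root d (norm t)"
    have "root d (norm t) \<le> root d R" using that d by (intro real_root_le_mono) auto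
    also have "root d R = Y / e" using d Y e unfolding R_def by (intro real_root_power_cancel) auto
    finally have y: "0 \<le> y" "y \<le> Y" using e by (auto simp: y_def field_simps intro!: mult_nonneg_nonneg real_root_ge_zero)
    have yt: "y ^ d = e ^ d * norm t" using d by (simp add: y_def power_mult_distrib)
    have "(1 - Y)^2 \<le> (1 - y)^2" using y Y by (intro power_mono) auto
    moreover have "(1 - y)^2 \<le> y ^ d + e - real d * y"
      using power_tangent_gap[OF d, of y] y Y by (simp add: e_def)
    moreover have "y ^ d * (1 - Y)^2 \<le> 1 * (1 - Y)^2"
      using y Y by (intro mult_right_mono power_le_one) auto
    ultimately have *: "real d * y \<le> e + y ^ d * (1 - (1 - Y)^2)" by (simp add: algebra_simps)
    have "real d * y < e + e * c * norm t"
    proof (cases "t = 0")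
      case True
      then show ?thesis using e d by (simp add: y_def)
    next
      case False
      have "y ^ d * (1 - (1 - Y)^2) = e * norm t * (e ^ (d - 1) * (1 - (1 - Y)^2))"
        by (simp add: yt ed)
      also have "\<dots> < e * norm t * c"
        using k1 e False by (intro mult_strict_left_mono) (auto simp: e_def)
      finally show ?thesis using * by (simp add: mult_ac)
    qed
    then have "e * (real d * root d (norm t)) < e * (1 + c * norm t)"
      by (simp add: y_def algebra_simps)
    then have "real d * root d (norm t) < 1 + c * norm t"
      using e by (subst (asm) mult_less_cancel_left_pos) auto
    then have "(real d * root d (norm t)) ^ d < (1 + c * norm t) ^ d"
      using d by (intro power_strict_mono) auto
    then show "real d ^ d * norm t < (1 + c * norm t) ^ d"
      using d by (simp add: power_mult_distrib)
  qed (use that in auto)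
  \<comment> \<open>The geometric series \<open>1 / (1 - x z)\<close> at
    \<open>z = diag_map d c t\<close>, divided by \<open>1 + c t\<close>; it generates the
    polynomials \<open>\<Sum>j\<le>n. x ^ j * tail_coeff d c n j\<close>.\<close>
  define f where "f = (\<lambda>x t. (1 + of_real c * t) ^ (d - 1) / ((1 + of_real c * t) ^ d - of_real x * t) :: complex)"
  \<comment> \<open>Joint continuity on a compact product yields one bound \<open>M\<close> valid
    for all \<open>x\<close>.\<close>
  have "continuous_on ({0..real d ^ d} \<times> cball 0 R) (\<lambda>p. f (fst p) (snd p))"
    unfolding f_def by (intro continuous_intros) (use nz in auto)
  then have "compact ((\<lambda>p. f (fst p) (snd p)) ` ({0..real d ^ d} \<times> cball 0 R))"
    by (intro compact_continuous_image compact_Times) auto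
  then have "bounded ((\<lambda>p. f (fst p) (snd p)) ` ({0..real d ^ d} \<times> cball 0 R))"
    by (rule compact_imp_bounded)
  then obtain M where "\<forall>p\<in>{0..real d ^ d} \<times> cball 0 R. norm (f (fst p) (snd p)) \<le> M"
    unfolding bounded_iff by blast
  then have M: "norm (f x t) \<le> M" if "x \<in> {0..real d ^ d}" "norm t \<le> R" for x t
    using that by force
  have P: "\<bar>\<Sum>j\<le>n. tail_coeff d c n j * x ^ j\<bar> \<le> M / R ^ n" if x: "x \<in> {0..real d ^ d}" for n x
  proof -
    obtain \<rho> where \<rho>: "\<rho> > 0" "\<And>u. 0 \<le> u \<Longrightarrow> u < \<rho> \<Longrightarrow> \<bar>c\<bar> * u < 1"
      "\<And>u. 0 \<le> u \<Longrightarrow> u < \<rho> \<Longrightarrow> real d ^ d * u < (1 - \<bar>c\<bar> * u) ^ d"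
      by (rule small_disc[of c "real d ^ d" d]) blast
    have hol: "f x holomorphic_on ball 0 R"
      unfolding f_def by (intro holomorphic_intros) (use nz x in auto)
    have cont: "continuous_on (cball 0 R) (f x)"
      unfolding f_def by (intro continuous_intros) (use nz x in auto)
    \<comment> \<open>Agreement of the two series near 0 suffices to identify the coefficients,
      which are then estimated on the whole disc.\<close>
    have "of_real (\<Sum>j\<le>n. x ^ j * tail_coeff d c n j) = (deriv ^^ n) (f x) 0 / fact n"
    proof (rule powser_coeff_eq[of "min \<rho> R" _ "f x"])
      fix t :: complex assume t: "norm t < min \<rho> R"
      show "(\<lambda>n. (deriv ^^ n) (f x) 0 / fact n * t ^ n) sums f x t"
        using holomorphic_power_series[OF hol, of t] t by simp
      define z where "z = diag_map d c t"
      note small = \<rho>(2,3)[of "norm t"]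
      have t1: "1 + of_real c * t \<noteq> 0"
        using one_plus_nonzero[of c t] small t by simp
      have "norm (of_real x * z) \<le> real d ^ d * norm z"
        using x by (auto simp: norm_mult intro: mult_right_mono)
      also have "\<dots> < 1"
        using norm_diag_map_less[of d c t] small t d by (simp add: z_def field_simps)
      finally have "norm (of_real x * z) < 1" .
      then have "(\<lambda>j. (of_real x * z) ^ j) sums (1 / (1 - of_real x * z))" by (rule geometric_sums)
      then have sums: "(\<lambda>j. of_real (x ^ j) * z ^ j) sums (1 / (1 - of_real x * z))"
        by (simp add: power_mult_distrib)
      have xX: "\<bar>x ^ j\<bar> \<le> (real d ^ d) ^ j" for j
        unfolding power_abs using x by (intro power_mono) auto
      have "(\<lambda>n. of_real (\<Sum>j\<le>n. x ^ j * tail_coeff d c n j) * t ^ n) sums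
              (1 / (1 - of_real x * z) / (1 + of_real c * t))"
      proof (rule tail_coeff_sums[where X = "real d ^ d" and B = "\<lambda>j. x ^ j"])
        show "\<bar>x ^ j\<bar> \<le> (real d ^ d) ^ j" for j by (rule xX)
        show "\<bar>c\<bar> * norm t < 1" "real d ^ d * norm t < (1 - \<bar>c\<bar> * norm t) ^ d"
          using \<rho>(2,3)[of "norm t"] t by auto
        show "(\<lambda>j. of_real (x ^ j) * (t / (1 + of_real c * t) ^ d) ^ j) sums (1 / (1 - of_real x * z))"
          using sums unfolding z_def diag_map_def .
      qed simp
      also have "1 / (1 - of_real x * z) / (1 + of_real c * t) = f x t"
      proof -
        have "(1 + of_real c * t) ^ d = (1 + of_real c * t) * (1 + of_real c * t) ^ (d - 1)"
          using d by (cases d) auto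
        then show ?thesis using t1 nz[OF x, of t] t
          by (simp add: f_def z_def diag_map_def divide_simps)
      qed
      finally show "(\<lambda>n. of_real (\<Sum>j\<le>n. x ^ j * tail_coeff d c n j) * t ^ n) sums f x t" .
    qed (use \<rho> R in auto)
    moreover have "norm ((deriv ^^ n) (f x) 0) \<le> fact n * M / R ^ n"
      by (rule Cauchy_inequality[OF hol cont R]) (use M x in auto)
    ultimately have "norm (of_real (\<Sum>j\<le>n. x ^ j * tail_coeff d c n j) :: complex) \<le> M / R ^ n"
      by (simp add: norm_divide divide_le_eq mult_ac)
    then show ?thesis unfolding norm_of_real by (simp add: mult_ac)
  qed
  show thesis
  proof (rule that[of M])
    fix n
    have "\<bar>\<Sum>j\<le>n. tail_coeff d c n j * (fact (d * j) / fact j ^ d)\<bar> \<le> M / R ^ n"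
      by (rule sum_multinomial_bound) (use d P in auto)
    also have "(\<Sum>j\<le>n. tail_coeff d c n j * (fact (d * j) / fact j ^ d)) = delta d c n"
      using d by (simp add: delta_eq tail_coeff_def mult_ac)
    also have "M / R ^ n = M * ((real d - 1) / Y) ^ (d * n)"
      using Y e by (simp add: R_def e_def power_mult power_divide)
    finally show "\<bar>delta d c n\<bar> \<le> M * ((real d - 1) / Y) ^ (d * n)" .
  qed
qed

section \<open>Lower bound for the growth rate\<close>

text \<open>Where both sides of the identity between the diagonal series and the multinomial series
  make sense: \<open>t\<close> is in the disc on which the former is assumed to converge, and the
  argument of the latter is within its radius of convergence.\<close>

definition diag_region :: "nat \<Rightarrow> real \<Rightarrow> real \<Rightarrow> complex set" where
  "diag_region d c R = {t \<in> ball 0 R. 1 + of_real c * t \<noteq> 0 \<and> norm (diag_map d c t) < 1 / real d ^ d}"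

lemma open_diag_region: "open (diag_region d c R)"
proof -
  have "open (ball 0 R \<inter> {t::complex. 1 + of_real c * t \<noteq> 0})"
    by (intro open_Int open_ball open_Collect_neq continuous_intros)
  moreover have "continuous_on (ball 0 R \<inter> {t::complex. 1 + of_real c * t \<noteq> 0}) (diag_map d c)"
    unfolding diag_map_def by (intro continuous_intros) auto
  ultimately have "open ((ball 0 R \<inter> {t::complex. 1 + of_real c * t \<noteq> 0}) \<inter> diag_map d c -` ball 0 (1 / real d ^ d))"
    by (intro continuous_open_preimage) auto
  also have "\<dots> = diag_region d c R" by (auto simp: diag_region_def)
  finally show ?thesis .
qed

lemma has_field_derivative_diag_map:
  assumes "d > 0" "1 + of_real c * t \<noteq> 0"
  shows "(diag_map d c has_field_derivative
           ((1 - of_real ((real d - 1) * c) * t) / (1 + of_real c * t) ^ Suc d)) (at t)"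
proof -
  obtain k where k: "d = Suc k" using assms(1) by (cases d) auto
  define u where "u = 1 + of_real c * t"
  have u: "u \<noteq> 0" using assms(2) by (simp add: u_def)
  have "(diag_map d c has_field_derivative
          (1 * u ^ d - t * (of_nat d * (of_real c * u ^ (d - 1)))) / (u ^ d * u ^ d)) (at t)"
    unfolding diag_map_def u_def using assms(2)
    by (intro DERIV_divide DERIV_ident) (auto intro!: derivative_eq_intros)
  also have "1 * u ^ d - t * (of_nat d * (of_real c * u ^ (d - 1))) = u ^ k * (1 - of_real ((real d - 1) * c) * t)"
    by (simp add: k u_def algebra_simps)
  also have "\<dots> / (u ^ d * u ^ d) = (1 - of_real ((real d - 1) * c) * t) / u ^ Suc d"
    using u by (simp add: k)
  finally show ?thesis by (simp add: u_def)
qed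

section \<open>Derivatives of the multinomial series\<close>

lemma funpow_diffs_of_real:
  "(diffs ^^ m) (\<lambda>n. of_real (a n)) = (\<lambda>n. of_real ((diffs ^^ m) a n) :: complex)"
  by (induction m) (simp_all add: diffs_def fun_eq_iff)

text \<open>The iterate is \<open>(n + 1) * ... * (n + m) * a (n + m)\<close>, with every integer
  factor at least \<open>n + 1\<close>.\<close>

lemma funpow_diffs_ge:
  fixes a :: "nat \<Rightarrow> real"
  assumes "\<And>n. a n \<ge> 0"
  shows "(diffs ^^ m) a n \<ge> real (n + 1) ^ m * a (n + m)"
proof (induction m arbitrary: n)
  case (Suc m)
  have "real (n + 1) ^ m * a (n + 1 + m) \<le> real (n + 1 + 1) ^ m * a (n + 1 + m)"
    using assms by (intro mult_right_mono power_mono) auto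
  also have "\<dots> \<le> (diffs ^^ m) a (n + 1)" by (rule Suc.IH)
  finally have "real (n + 1) * (real (n + 1) ^ m * a (n + 1 + m)) \<le> real (n + 1) * (diffs ^^ m) a (n + 1)"
    by (intro mult_left_mono) auto
  then show ?case by (simp add: diffs_def[of "(diffs ^^ m) a"] mult_ac)
qed simp

lemma summable_funpow_diffs:
  fixes a :: "nat \<Rightarrow> complex"
  assumes "\<And>w. norm w < K \<Longrightarrow> summable (\<lambda>n. a n * w ^ n)" "norm w < K"
  shows "summable (\<lambda>n. (diffs ^^ m) a n * w ^ n)"
  using assms(2)
proof (induction m arbitrary: w)
  case (Suc m)
  show ?case unfolding funpow.simps o_apply
    by (rule termdiff_converges[OF Suc.prems Suc.IH])
qed (simp add: assms(1))

lemma multinomial_series_summable: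
  fixes w :: complex
  assumes "d > 0" "norm w < 1 / real d ^ d"
  shows "summable (\<lambda>j. of_real (fact (d * j) / fact j ^ d) * w ^ j)"
proof (rule summable_comparison_test'[OF summable_geometric])
  show "norm (real d ^ d * norm w) < 1" using assms by (simp add: field_simps)
  fix j
  have "norm (of_real (fact (d * j) / fact j ^ d) * w ^ j) \<le> real d ^ (d * j) * norm w ^ j"
    unfolding norm_mult norm_power norm_of_real
    using multinomial_le[OF assms(1), of j] by (intro mult_right_mono) auto
  then show "norm (of_real (fact (d * j) / fact j ^ d) * w ^ j) \<le> (real d ^ d * norm w) ^ j"
    by (simp add: power_mult_distrib power_mult)
qed

text \<open>The multinomial coefficients lose at most a power of degree \<open>d - 1\<close> against
  \<open>d ^ (d j)\<close>, while \<open>d\<close> differentiations gain a power of degree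
  \<open>d\<close>; so the terms at the singularity grow at least linearly.\<close>

lemma diffs_multinomial_unbounded:
  assumes d: "d \<ge> 2"
  shows "\<exists>n. (diffs ^^ d) (\<lambda>j. fact (d * j) / fact j ^ d) n * (1 / real d ^ d) ^ n > (B::real)"
proof -
  \<comment> \<open>The constant in the lower bound \<open>N * K\<close>, obtained from
    \<open>multinomial_ge\<close> at index \<open>n + d\<close> and
    \<open>n + d \<le> d * (n + 1)\<close>.\<close>
  define K where "K = real d ^ (d * d) / (real d * real d) ^ (d - 1)"
  have "K > 0" using d by (simp add: K_def)
  obtain n :: nat where n: "B / K < real n" using reals_Archimedean2 by blast
  define N where "N = real (n + 1)"
  have N: "N > 0" by (simp add: N_def)
  have "N * K = N ^ d * (real d ^ (d * d) * (1 / (real d * (real d * N))) ^ (d - 1))"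
  proof -
    have "N ^ d = N * N ^ (d - 1)" using d by (cases d) auto
    then show ?thesis using N d by (simp add: K_def power_mult_distrib power_divide divide_simps)
  qed
  also have "\<dots> \<le> N ^ d * (real d ^ (d * d) * (1 / (real d * real (n + d))) ^ (d - 1))"
  proof -
    have "n + d \<le> d * (n + 1)" using d by (simp add: algebra_simps)
    then have "real (n + d) \<le> real d * N" unfolding N_def by (metis of_nat_le_iff of_nat_mult)
    then have "1 / (real d * (real d * N)) \<le> 1 / (real d * real (n + d))"
      using d N by (intro divide_left_mono mult_left_mono mult_pos_pos) auto
    then show ?thesis using d N by (intro mult_left_mono power_mono) auto
  qed
  also have "\<dots> = N ^ d * ((real d ^ (d * (n + d)) * (1 / (real d * real (n + d))) ^ (d - 1)) * (1 / real d ^ d) ^ n)"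
    using d by (simp add: power_add power_mult power_divide distrib_left)
  also have "\<dots> \<le> N ^ d * ((fact (d * (n + d)) / fact (n + d) ^ d) * (1 / real d ^ d) ^ n)"
    using d N by (intro mult_left_mono mult_right_mono multinomial_ge) auto
  also have "\<dots> = (real (n + 1) ^ d * (fact (d * (n + d)) / fact (n + d) ^ d)) * (1 / real d ^ d) ^ n"
    by (simp add: N_def)
  also have "\<dots> \<le> (diffs ^^ d) (\<lambda>j. fact (d * j) / fact j ^ d) n * (1 / real d ^ d) ^ n"
    using funpow_diffs_ge[of "\<lambda>j. fact (d * j) / fact j ^ d" n d] by (intro mult_right_mono) auto
  finally have "N * K \<le> (diffs ^^ d) (\<lambda>j. fact (d * j) / fact j ^ d) n * (1 / real d ^ d) ^ n" .
  moreover have "B < N * K"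
    using n \<open>K > 0\<close> by (simp add: N_def divide_simps algebra_simps)
  ultimately show ?thesis by (intro exI[of _ n]) linarith
qed

text \<open>
  If the diagonal series \<open>\<Delta>\<close> converged on a disc meeting a preimage \<open>p s\<close> of the singularity
  \<open>d ^ - d\<close> of the series \<open>H\<close> of multinomial coefficients, then differentiating
  \<open>(1 + c t) \<Delta>(t) = H(t / (1 + c t) ^ d)\<close> would bound the derivatives of \<open>H\<close> near
  \<open>d ^ - d\<close>. The path keeps the argument of \<open>H\<close> real, so that monodromy plays no role.
\<close>

lemma no_continuation:
  fixes p :: "real \<Rightarrow> complex" and y :: "real \<Rightarrow> real"
  assumes d: "d \<ge> 2" and R: "R > 0"
    and conv: "\<And>t::complex. norm t < R \<Longrightarrow> summable (\<lambda>n. of_real (delta d c n) * t ^ n)"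
    and p: "a \<le> b" "continuous_on {a..b} p" "\<And>s. s \<in> {a..b} \<Longrightarrow> norm (p s) < R"
      "\<And>s. s \<in> {a..b} \<Longrightarrow> 1 + of_real c * p s \<noteq> 0"
    and y: "\<And>s. s \<in> {a..b} \<Longrightarrow> diag_map d c (p s) = of_real (y s)" "\<And>s. s \<in> {a..b} \<Longrightarrow> y s \<ge> 0"
    and start: "connected_component (diag_region d c R) 0 (p a)"
    and hit: "y b \<ge> 1 / real d ^ d"
    and noncrit: "\<And>s. s \<in> {a..b} \<Longrightarrow> y s = 1 / real d ^ d \<Longrightarrow> 1 - of_real ((real d - 1) * c) * p s \<noteq> 0"
  shows False
proof -
  define z0 where "z0 = 1 / real d ^ d"
  define S where "S = connected_component_set (diag_region d c R) 0"
  define A where "A = (\<lambda>j. fact (d * j) / fact j ^ d :: real)"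
  define H where "H = (\<lambda>m w. \<Sum>n. (diffs ^^ m) (\<lambda>n. of_real (A n)) n * w ^ n :: complex)"
  define G where "G = (\<lambda>t::complex. (1 + of_real c * t) * (\<Sum>n. of_real (delta d c n) * t ^ n))"
  \<comment> \<open>\<open>V\<close> omits the critical point of \<open>diag_map\<close>, where
    derivatives of \<open>H\<close> cannot be recovered by dividing by the derivative of the
    map.\<close>
  define V :: "complex set" where "V = {t \<in> ball 0 R. 1 + of_real c * t \<noteq> 0 \<and> 1 - of_real ((real d - 1) * c) * t \<noteq> 0}"
  have z0: "z0 > 0" using d by (simp add: z0_def)
  have openS: "open S" unfolding S_def by (intro open_connected_component open_diag_region)
  have connS: "connected S" unfolding S_def by (rule connected_connected_component)
  have SU: "S \<subseteq> diag_region d c R" unfolding S_def by (rule connected_component_subset)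
  have S: "norm t < R" "1 + of_real c * t \<noteq> 0" "norm (diag_map d c t) < z0" if "t \<in> S" for t
    using that SU by (auto simp: diag_region_def z0_def)
  have "V = ball 0 R \<inter> ({t. 1 + of_real c * t \<noteq> 0} \<inter> {t. 1 - of_real ((real d - 1) * c) * t \<noteq> 0})"
    by (auto simp: V_def)
  moreover have "open \<dots>"
    by (intro open_Int open_ball open_Collect_neq continuous_intros)
  ultimately have openV: "open V" by simp
  have sumH: "summable (\<lambda>n. (diffs ^^ m) (\<lambda>n. of_real (A n)) n * w ^ n)" if "norm w < z0" for m and w :: complex
    by (rule summable_funpow_diffs[OF _ that])
       (use multinomial_series_summable[of d] d in \<open>auto simp: A_def z0_def\<close>)
  have derivH: "(H m has_field_derivative H (Suc m) w) (at w)" if "norm w < z0" for m w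
    unfolding H_def funpow.simps o_apply
    by (rule termdiffs_strong'[OF sumH that])
  have derivz: "(diag_map d c has_field_derivative
           ((1 - of_real ((real d - 1) * c) * t) / (1 + of_real c * t) ^ Suc d)) (at t)"
    if "1 + of_real c * t \<noteq> 0" for t
    using has_field_derivative_diag_map[OF _ that] d by simp
  have holG: "G holomorphic_on ball 0 R"
  proof -
    have "(\<lambda>t::complex. \<Sum>n. of_real (delta d c n) * t ^ n) holomorphic_on ball 0 R"
      by (rule power_series_holomorphic[where a = "\<lambda>n. of_real (delta d c n)"])
         (use conv in \<open>auto intro: summable_sums\<close>)
    then show ?thesis unfolding G_def by (intro holomorphic_intros)
  qed
  have holH: "(\<lambda>t. H 0 (diag_map d c t)) holomorphic_on S"
    unfolding holomorphic_on_open[OF openS]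
    using DERIV_chain2[OF derivH derivz] S by blast
  \<comment> \<open>Near 0 this is the rearrangement of the double series; analytic continuation
    extends it to the component \<open>S\<close>.\<close>
  have GH: "G t = H 0 (diag_map d c t)" if "t \<in> S" for t
  proof -
    obtain \<rho> where \<rho>: "\<rho> > 0" "\<And>u. 0 \<le> u \<Longrightarrow> u < \<rho> \<Longrightarrow> \<bar>c\<bar> * u < 1"
      "\<And>u. 0 \<le> u \<Longrightarrow> u < \<rho> \<Longrightarrow> real d ^ d * u < (1 - \<bar>c\<bar> * u) ^ d"
      by (rule small_disc[of c "real d ^ d" d]) blast
    have small: "norm t < R" "\<bar>c\<bar> * norm t < 1" "real d ^ d * norm t < (1 - \<bar>c\<bar> * norm t) ^ d"
      if "t \<in> ball 0 (min \<rho> R)" for t :: complex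
      using \<rho>(2,3)[of "norm t"] that by auto
    have sub: "ball 0 (min \<rho> R) \<subseteq> S"
      unfolding S_def
    proof (rule connected_component_maximal)
      show "ball 0 (min \<rho> R) \<subseteq> diag_region d c R"
        using small one_plus_nonzero norm_diag_map_less[of d c] d by (auto simp: diag_region_def)
    qed (use \<rho> R in auto)
    have near0: "G t = H 0 (diag_map d c t)" if t: "t \<in> ball 0 (min \<rho> R)" for t
    proof -
      have t1: "1 + of_real c * t \<noteq> 0" using one_plus_nonzero small(2)[OF t] by blast
      have "norm (diag_map d c t) < z0"
        unfolding z0_def using norm_diag_map_less[OF _ small(2,3)[OF t]] d by simp
      then have "(\<lambda>j. of_real (A j) * diag_map d c t ^ j) sums H 0 (diag_map d c t)"
        using sumH[of "diag_map d c t" 0] by (simp add: H_def summable_sums)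
      then have "(\<lambda>n. of_real (\<Sum>j\<le>n. A j * tail_coeff d c n j) * t ^ n) sums
              (H 0 (diag_map d c t) / (1 + of_real c * t))"
        unfolding diag_map_def using small[OF t] multinomial_le[of d] d
        by (intro tail_coeff_sums[where X = "real d ^ d"]) (auto simp: A_def power_mult)
      moreover have "(\<Sum>j\<le>n. A j * tail_coeff d c n j) = delta d c n" for n
        using d by (simp add: delta_eq A_def tail_coeff_def)
      ultimately show ?thesis using t1 by (simp add: G_def sums_iff)
    qed
    show ?thesis
    proof (rule analytic_continuation_open[OF open_ball openS _ connS sub _ holH near0 that])
      show "G holomorphic_on S" using holG S(1) by (auto intro: holomorphic_on_subset)
    qed (use \<rho> R in auto)
  qed
  \<comment> \<open>The chain rule is solved for the next derivative of \<open>H\<close>. The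
    quotient is holomorphic on all of \<open>V\<close>, including points at which the argument of
    \<open>H\<close> has reached the singularity.\<close>
  have ex: "\<exists>g. g holomorphic_on V \<and> (\<forall>t\<in>S \<inter> V. g t = H m (diag_map d c t))" for m
  proof (induction m)
    case 0
    have "G holomorphic_on V" using holG by (rule holomorphic_on_subset) (auto simp: V_def)
    then show ?case using GH by blast
  next
    case (Suc m)
    then obtain g where g: "g holomorphic_on V" "\<And>t. t \<in> S \<inter> V \<Longrightarrow> g t = H m (diag_map d c t)" by blast
    define g' where "g' = (\<lambda>t. deriv g t * (1 + of_real c * t) ^ Suc d / (1 - of_real ((real d - 1) * c) * t))"
    have "g' holomorphic_on V"
      unfolding g'_def by (intro holomorphic_intros g openV) (auto simp: V_def)
    moreover have "g' t = H (Suc m) (diag_map d c t)" if t: "t \<in> S \<inter> V" for t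
    proof -
      have "((\<lambda>t. H m (diag_map d c t)) has_field_derivative
          (H (Suc m) (diag_map d c t) *
            ((1 - of_real ((real d - 1) * c) * t) / (1 + of_real c * t) ^ Suc d))) (at t)"
        using t S by (intro DERIV_chain2[OF derivH derivz]) auto
      then have "(g has_field_derivative
          (H (Suc m) (diag_map d c t) *
            ((1 - of_real ((real d - 1) * c) * t) / (1 + of_real c * t) ^ Suc d))) (at t)"
        by (rule has_field_derivative_transform_within_open[OF _ open_Int[OF openS openV] t])
           (use g(2) in simp)
      then have "deriv g t = H (Suc m) (diag_map d c t) *
            ((1 - of_real ((real d - 1) * c) * t) / (1 + of_real c * t) ^ Suc d)"
        by (rule DERIV_imp_deriv)
      then show ?thesis using t unfolding g'_def by (simp add: V_def del: power_Suc)
    qed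
    ultimately show ?case by blast
  qed
  from ex[of d] obtain g where g: "g holomorphic_on V" "\<And>t. t \<in> S \<inter> V \<Longrightarrow> g t = H d (diag_map d c t)"
    by blast
  have cont_y: "continuous_on {a..b} y"
  proof -
    have "continuous_on {a..b} (\<lambda>s. Re (p s / (1 + of_real c * p s) ^ d))"
      by (intro continuous_intros p(2)) (use p(4) in auto)
    then show ?thesis
      by (rule continuous_on_eq) (use y(1) in \<open>simp add: diag_map_def\<close>)
  qed
  have "closed {s \<in> {a..b}. z0 \<le> y s}"
    by (intro continuous_on_closed_Collect_le cont_y continuous_intros)
  then have "compact {s \<in> {a..b}. z0 \<le> y s}"
    unfolding compact_eq_bounded_closed
    by (auto intro: bounded_subset[OF bounded_closed_interval[of a b]])
  moreover have "b \<in> {s \<in> {a..b}. z0 \<le> y s}" using p(1) hit by (auto simp: z0_def)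
  \<comment> \<open>\<open>s1\<close> is the first parameter at which the singularity is reached;
    before it the path stays in the component \<open>S\<close>.\<close>
  ultimately obtain s1 where s1: "s1 \<in> {a..b}" "z0 \<le> y s1"
      and min: "\<And>s. s \<in> {a..b} \<Longrightarrow> z0 \<le> y s \<Longrightarrow> s1 \<le> s"
    using continuous_attains_inf[of "{s \<in> {a..b}. z0 \<le> y s}" "\<lambda>s. s"] by auto
  have below: "y s < z0" if "s \<in> {a..<s1}" for s
    using min[of s] s1(1) that by force
  have paS: "p a \<in> S" using start by (simp add: S_def)
  have "y a < z0" using S(3)[OF paS] y[of a] p(1) by simp
  then have as1: "a < s1" using s1 by (cases "a = s1") auto
  have sub: "p ` {a..<s1} \<subseteq> S"
  proof -
    have "connected (p ` {a..<s1})"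
      by (rule connected_continuous_image) (use p(2) s1 in \<open>auto intro: continuous_on_subset\<close>)
    moreover have "p ` {a..<s1} \<subseteq> diag_region d c R"
      using p(3,4) y below s1(1) by (force simp: diag_region_def z0_def)
    moreover have "p a \<in> p ` {a..<s1}" using as1 by auto
    ultimately have "p ` {a..<s1} \<subseteq> connected_component_set (diag_region d c R) (p a)"
      by (intro connected_component_maximal)
    also have "\<dots> = S" unfolding S_def using start by (metis connected_component_eq mem_Collect_eq)
    finally show ?thesis .
  qed
  define L where "L = at s1 within {a..<s1}"
  have "s1 islimpt {a..<s1}"
    by (rule islimpt_subset[OF islimpt_greaterThanLessThan2[OF as1]]) auto
  then have L: "L \<noteq> bot" by (simp add: L_def trivial_limit_within)
  have in_L: "eventually (\<lambda>s. s \<in> {a..<s1}) L" unfolding L_def by (simp add: eventually_at_filter)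
  have lim_p: "(p \<longlongrightarrow> p s1) L" and lim_y: "(y \<longlongrightarrow> y s1) L"
    using p(2) cont_y s1(1) unfolding L_def continuous_on_def
    by (auto intro: tendsto_within_subset[where S = "{a..b}"])
  have "y s1 \<le> z0"
    by (rule tendsto_upperbound[OF lim_y _ L]) (use in_L below in \<open>auto elim!: eventually_mono intro: less_imp_le\<close>)
  with s1 have ys1: "y s1 = z0" by simp
  have ps1: "p s1 \<in> V"
    using p(3,4) noncrit s1(1) ys1 by (auto simp: V_def z0_def)
  have "isCont g (p s1)"
    using g(1) openV ps1 by (metis holomorphic_on_imp_continuous_on continuous_on_eq_continuous_at)
  then have lim_g: "((\<lambda>s. norm (g (p s))) \<longlongrightarrow> norm (g (p s1))) L"
    by (intro tendsto_norm isCont_tendsto_compose[OF _ lim_p])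
  have in_V: "eventually (\<lambda>s. p s \<in> V) L"
    using lim_p openV ps1 by (rule topological_tendstoD)
  have A: "A n \<ge> 0" for n by (simp add: A_def)
  have dA: "(diffs ^^ d) A n \<ge> 0" for n
    by (rule order.trans[OF _ funpow_diffs_ge[OF A]]) (simp add: A)
  \<comment> \<open>A single term is at most the whole series of nonnegative terms, whose sum at
    \<open>y s\<close> is \<open>g (p s)\<close>. Letting \<open>s\<close> tend to \<open>s1\<close>
    bounds all terms at the singularity by one number.\<close>
  have "(diffs ^^ d) A n * z0 ^ n \<le> norm (g (p s1))" for n
  proof (rule tendsto_le[OF L lim_g])
    show "((\<lambda>s. (diffs ^^ d) A n * y s ^ n) \<longlongrightarrow> (diffs ^^ d) A n * z0 ^ n) L"
      using lim_y unfolding ys1 by (intro tendsto_intros)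
    show "eventually (\<lambda>s. (diffs ^^ d) A n * y s ^ n \<le> norm (g (p s))) L"
      using in_L in_V
    proof eventually_elim
      case (elim s)
      then have s: "s \<in> {a..b}" "p s \<in> S \<inter> V" "y s < z0" using sub below s1(1) by auto
      have "norm (of_real (y s) :: complex) < z0" using s y(2) by simp
      from sumH[OF this, of d]
      have "summable (\<lambda>n. complex_of_real ((diffs ^^ d) A n * y s ^ n))"
        by (simp add: funpow_diffs_of_real)
      then have sm: "summable (\<lambda>n. (diffs ^^ d) A n * y s ^ n)"
        by (simp only: summable_complex_of_real)
      have "g (p s) = H d (of_real (y s))" using g(2)[OF s(2)] y(1)[OF s(1)] by simp
      also have "\<dots> = of_real (\<Sum>n. (diffs ^^ d) A n * y s ^ n)"
        unfolding suminf_of_real[OF sm] H_def by (simp add: funpow_diffs_of_real)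
      finally have "norm (g (p s)) = \<bar>\<Sum>n. (diffs ^^ d) A n * y s ^ n\<bar>" by (simp only: norm_of_real)
      moreover have "(\<Sum>n\<in>{n}. (diffs ^^ d) A n * y s ^ n) \<le> (\<Sum>n. (diffs ^^ d) A n * y s ^ n)"
        by (rule sum_le_suminf[OF sm]) (use dA y(2)[OF s(1)] in auto)
      ultimately show ?case by simp
    qed
  qed
  moreover obtain n where "(diffs ^^ d) A n * z0 ^ n > norm (g (p s1))"
    using diffs_multinomial_unbounded[OF d] unfolding A_def z0_def by blast
  ultimately show False by (meson not_less)
qed

section \<open>Below the critical value: a real path\<close>

lemma zero_in_diag_region:
  assumes "d > 0" "R > 0"
  shows "0 \<in> diag_region d c R"
  using assms by (simp add: diag_region_def diag_map_def)

text \<open>The path is the real segment from 0 to the critical point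
  \<open>b = 1 / (c * (d - 1))\<close>. There \<open>y b\<close> is
  \<open>(d - 1) ^ (d - 1) / c\<close> times \<open>1 / d ^ d\<close>, hence beyond the singularity,
  so the singularity is met strictly before the critical point.\<close>

lemma no_continuation_left:
  assumes d: "d \<ge> 2" and c: "0 < c" "c < (real d - 1) ^ (d - 1)"
    and R: "1 / (c * (real d - 1)) < R"
  shows "\<not> (\<forall>t::complex. norm t < R \<longrightarrow> summable (\<lambda>n. of_real (delta d c n) * t ^ n))"
proof
  assume conv: "\<forall>t::complex. norm t < R \<longrightarrow> summable (\<lambda>n. of_real (delta d c n) * t ^ n)"
  define e where "e = real d - 1"
  have e: "e \<ge> 1" using d by (simp add: e_def)
  define b where "b = 1 / (c * e)"
  define y where "y = (\<lambda>s. s / (1 + c * s) ^ d)"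
  have b: "b > 0" "b < R" using c e R by (auto simp: b_def e_def)
  have pos: "1 + c * s > 0" if "s \<ge> 0" for s using that c by (simp add: add_pos_nonneg)
  have yb: "y b > 1 / real d ^ d"
  proof -
    obtain k where k: "d = Suc k" using d by (cases d) auto
    have "1 + c * b = real d / e" using c e by (simp add: b_def e_def field_simps)
    then have "y b = 1 / (c * e) * (e ^ d / real d ^ d)" by (simp add: y_def power_divide b_def)
    also have "\<dots> = e ^ (d - 1) / c * (1 / real d ^ d)" using e by (simp add: k)
    finally have yb: "y b = e ^ (d - 1) / c * (1 / real d ^ d)" .
    have "1 < e ^ (d - 1) / c" using c by (simp add: e_def)
    then have "1 * (1 / real d ^ d) < e ^ (d - 1) / c * (1 / real d ^ d)"
      using d by (intro mult_strict_right_mono) auto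
    then show ?thesis unfolding yb by simp
  qed
  show False
  proof (rule no_continuation[OF d, where p = of_real and y = y and a = 0 and b = b])
    show "1 / real d ^ d \<le> y b" using yb by simp
    show "0 < R" using b by simp
    show "summable (\<lambda>n. of_real (delta d c n) * t ^ n)" if "norm t < R" for t :: complex
      using conv that by blast
    show "0 \<le> b" using b by simp
    show "continuous_on {0..b} (of_real :: real \<Rightarrow> complex)" by (intro continuous_intros)
    fix s assume s: "s \<in> {0..b}"
    show "norm (of_real s :: complex) < R" using s b by simp
    show "1 + complex_of_real c * complex_of_real s \<noteq> 0"
      using pos[of s] s by (metis atLeastAtMost_iff less_irrefl of_real_1 of_real_add of_real_eq_0_iff of_real_mult)
    show "diag_map d c (of_real s) = of_real (y s)" by (simp add: diag_map_def y_def)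
    show "y s \<ge> 0" using s pos[of s] by (simp add: y_def)
    assume "y s = 1 / real d ^ d"
    then have "s \<noteq> b" using yb by auto
    then have "1 - e * c * s \<noteq> 0" using c e by (auto simp: b_def field_simps)
    then show "1 - of_real ((real d - 1) * c) * complex_of_real s \<noteq> 0"
      unfolding e_def by (metis of_real_0 of_real_1 of_real_diff of_real_eq_iff of_real_mult)
  next
    show "connected_component (diag_region d c R) 0 (of_real 0)"
      using zero_in_diag_region[of d R c] d b by (simp add: connected_component_refl)
  qed
qed

section \<open>Above the critical value: a complex path\<close>

lemma sin_div_decreasing:
  assumes "0 < x" "x < y" "y < pi"
  shows "x * sin y < y * sin x"
proof -
  \<comment> \<open>This gives the sign of the derivative of \<open>sin t / t\<close>; it holds
    because \<open>sin t - t * cos t\<close> vanishes at 0 and has derivative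
    \<open>t * sin t\<close>.\<close>
  have pos: "t * cos t < sin t" if "0 < t" "t < pi" for t
  proof -
    have "sin 0 - 0 * cos 0 < sin t - t * cos t"
    proof (rule DERIV_pos_imp_increasing_open[where f = "\<lambda>t. sin t - t * cos t"])
      fix u assume u: "0 < u" "u < t"
      have "((\<lambda>t. sin t - t * cos t) has_real_derivative (u * sin u)) (at u)"
        by (auto intro!: derivative_eq_intros)
      moreover have "u * sin u > 0" using u that by (intro mult_pos_pos sin_gt_zero) auto
      ultimately show "\<exists>D. ((\<lambda>t. sin t - t * cos t) has_real_derivative D) (at u) \<and> D > 0" by blast
    qed (use that in \<open>auto intro!: continuous_intros\<close>)
    then show ?thesis by simp
  qed
  have "sin y / y < sin x / x"
  proof (rule DERIV_neg_imp_decreasing_open[where f = "\<lambda>t. sin t / t"])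
    fix u assume u: "x < u" "u < y"
    have "((\<lambda>t. sin t / t) has_real_derivative ((cos u * u - sin u) / (u * u))) (at u)"
      using u assms by (auto intro!: derivative_eq_intros)
    moreover have "(cos u * u - sin u) / (u * u) < 0"
      using pos[of u] u assms by (intro divide_neg_pos) (auto simp: mult.commute)
    ultimately show "\<exists>D. ((\<lambda>t. sin t / t) has_real_derivative D) (at u) \<and> D < 0" by blast
  qed (use assms in \<open>auto intro!: continuous_intros\<close>)
  then show ?thesis using assms by (simp add: field_simps)
qed

text \<open>As \<open>sin t / t\<close> decreases,
  \<open>sin (d \<theta>) < d * sin \<theta>\<close> and
  \<open>(d - 1) * sin (d \<theta>) < d * sin ((d - 1) * \<theta>)\<close>; the first is multiplied
  by the \<open>(d - 1)\<close>-th power of the second. The right-hand side is the \<open>c\<close>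
  for which the curve in \<open>no_continuation_right\<close> meets the singularity at angle
  \<open>\<theta>\<close>.\<close>

lemma sin_quotient_gap:
  assumes d: "d \<ge> 2" and \<theta>: "0 < \<theta>" "\<theta> < pi / real d"
  shows "(real d - 1) ^ (d - 1) <
           real d ^ d * (sin \<theta> * sin ((real d - 1) * \<theta>) ^ (d - 1) / sin (real d * \<theta>) ^ d)"
proof -
  define e where "e = real d - 1"
  have e: "e \<ge> 1" using d by (simp add: e_def)
  define P Q S where "P = sin \<theta>" and "Q = sin (e * \<theta>)" and "S = sin (real d * \<theta>)"
  have dpi: "real d * \<theta> < pi" using \<theta> d by (simp add: field_simps)
  then have S: "S > 0" using \<theta> d unfolding S_def by (intro sin_gt_zero) auto
  have "\<theta> * S < (real d * \<theta>) * P"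
    unfolding S_def P_def using \<theta> d dpi by (intro sin_div_decreasing) auto
  then have P: "S < real d * P" using \<theta> by simp
  have "(e * \<theta>) * S < (real d * \<theta>) * Q"
    unfolding S_def Q_def using \<theta> d dpi e by (intro sin_div_decreasing) (auto simp: e_def)
  then have Q: "e * S < real d * Q" using \<theta> by simp
  obtain k where k: "d = Suc k" using d by (cases d) auto
  have "S * (e * S) ^ (d - 1) < (real d * P) * (real d * Q) ^ (d - 1)"
    by (rule mult_strict_mono[OF P power_strict_mono[OF Q]]) (use P S e d in auto)
  also have "S * (e * S) ^ (d - 1) = e ^ (d - 1) * S ^ d"
    by (simp add: k power_mult_distrib)
  also have "(real d * P) * (real d * Q) ^ (d - 1) = real d ^ d * (P * Q ^ (d - 1))"
    by (simp add: k power_mult_distrib)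
  finally show ?thesis using S unfolding P_def Q_def S_def e_def by (simp add: field_simps)
qed

lemma sin_quotient_tendsto:
  assumes "e \<noteq> (0::real)"
  shows "((\<lambda>\<theta>. sin \<theta> / sin (e * \<theta>)) \<longlongrightarrow> 1 / e) (at_right 0)"
proof -
  have "((\<lambda>\<theta>::real. sin (a * \<theta>)) has_real_derivative a) (at 0)" for a
    by (auto intro!: derivative_eq_intros)
  then have "((\<lambda>\<theta>. sin (a * \<theta>) / \<theta>) \<longlongrightarrow> a) (at 0)" for a :: real
    by (simp add: has_field_derivative_iff)
  from tendsto_divide[OF this[of 1] this[of e] assms]
  have "((\<lambda>\<theta>. (sin \<theta> / \<theta>) / (sin (e * \<theta>) / \<theta>)) \<longlongrightarrow> 1 / e) (at 0)" by simp
  then have "((\<lambda>\<theta>. (sin \<theta> / \<theta>) / (sin (e * \<theta>) / \<theta>)) \<longlongrightarrow> 1 / e) (at_right 0)"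
    by (rule tendsto_within_subset) simp
  then show ?thesis
    by (rule Lim_transform_eventually) (auto simp: eventually_at_filter)
qed

text \<open>Bernoulli's inequality at \<open>y = (d - 1) * root d s\<close> is the non-strict case
  of the critical value, and a larger \<open>c\<close> makes it strict. This keeps the real segment
  from 0 to the critical point inside \<open>diag_region\<close>.\<close>

lemma critical_segment:
  assumes d: "d \<ge> 2" and c: "c > (real d - 1) ^ (d - 1)" and s: "s \<ge> 0"
  shows "real d ^ d * s < (1 + c * s) ^ d"
proof -
  define e where "e = real d - 1"
  have e: "e \<ge> 1" using d by (simp add: e_def)
  have c0: "c > 0" using c e by (metis e_def less_trans zero_less_power less_le_trans zero_less_one)
  obtain k where k: "d = Suc k" using d by (cases d) auto
  define y where "y = e * root d s"
  have y: "y \<ge> 0" "y ^ d = e ^ d * s"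
    using d s e by (auto simp: y_def power_mult_distrib)
  have "1 + real d * (y - 1) \<le> (1 + (y - 1)) ^ d"
    using y by (intro Bernoulli_inequality) auto
  then have "real d * y \<le> e + e ^ d * s" using y by (simp add: e_def algebra_simps)
  then have "e * (real d * root d s) \<le> e * (1 + e ^ (d - 1) * s)"
    by (simp add: y_def k algebra_simps)
  then have le: "real d * root d s \<le> 1 + e ^ (d - 1) * s"
    using e by (subst (asm) mult_le_cancel_left_pos) auto
  show ?thesis
  proof (cases "s = 0")
    case False
    then have "e ^ (d - 1) * s < c * s" using c s by (simp add: e_def)
    with le have "real d * root d s < 1 + c * s" by simp
    then have "(real d * root d s) ^ d < (1 + c * s) ^ d"
      using d s by (intro power_strict_mono) auto
    then show ?thesis using d s by (simp add: power_mult_distrib)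
  qed simp
qed

text \<open>
  For \<open>c\<close> above the critical value the two preimages of \<open>d ^ - d\<close> are complex conjugates.
  The curve \<open>\<theta> \<mapsto> sin \<theta> cis (d \<theta>) / (c sin ((d - 1) \<theta>))\<close>, on which \<open>t / (1 + c t) ^ d\<close> is
  real, leads to one of them from the critical point \<open>1 / (c (d - 1))\<close>.
\<close>

lemma no_continuation_right:
  assumes d: "d \<ge> 2" and c: "c > (real d - 1) ^ (d - 1)"
    and R: "1 / ((real d - 1) ^ (d - 1) * (real d - 1)) < R"
    and b: "0 < b" "b < pi / real d"
    and close: "\<And>\<theta>. \<theta> \<in> {0<..b} \<Longrightarrow> sin \<theta> / sin ((real d - 1) * \<theta>) < (real d - 1) ^ (d - 1) * R"
    and c': "c \<le> real d ^ d * (sin b * sin ((real d - 1) * b) ^ (d - 1) / sin (real d * b) ^ d)"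
  shows "\<not> (\<forall>t::complex. norm t < R \<longrightarrow> summable (\<lambda>n. of_real (delta d c n) * t ^ n))"
proof
  assume conv: "\<forall>t::complex. norm t < R \<longrightarrow> summable (\<lambda>n. of_real (delta d c n) * t ^ n)"
  define e where "e = real d - 1"
  have e: "e \<ge> 1" using d by (simp add: e_def)
  define cs where "cs = e ^ (d - 1)"
  have cs: "cs \<ge> 1" using e by (simp add: cs_def)
  have c0: "c > cs" "c > 0" using c cs by (auto simp: cs_def e_def)
  have R0: "1 / (cs * e) < R" using R by (simp add: cs_def e_def)
  have "1 / (c * e) < 1 / (cs * e)" using c0 e cs by (intro divide_strict_left_mono) auto
  then have Rc: "1 / (c * e) < R" using R0 by simp
  have "1 / (c * e) > 0" using c0 e by simp
  then have Rpos: "R > 0" using Rc by linarith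
  define p where "p = (\<lambda>\<theta>. of_real (sin \<theta> / (c * sin (e * \<theta>))) * cis (real d * \<theta>))"
  define y where "y = (\<lambda>\<theta>. sin \<theta> * sin (e * \<theta>) ^ (d - 1) / (c * sin (real d * \<theta>) ^ d))"
  have sinpos: "sin \<theta> > 0" "sin (e * \<theta>) > 0" "sin (real d * \<theta>) > 0" if "\<theta> \<in> {0<..b}" for \<theta>
  proof -
    have "real d * \<theta> \<le> real d * b" using that by (intro mult_left_mono) auto
    also have "\<dots> < pi" using b d by (simp add: field_simps)
    finally have "real d * \<theta> < pi" .
    moreover have "e * \<theta> \<le> real d * \<theta>" "1 * \<theta> \<le> real d * \<theta>"
      using that d by (auto intro!: mult_right_mono simp: e_def)
    ultimately have "\<theta> < pi" "e * \<theta> < pi" "real d * \<theta> < pi" by linarith+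
    then show "sin \<theta> > 0" "sin (e * \<theta>) > 0" "sin (real d * \<theta>) > 0"
      using that e d by (auto intro!: sin_gt_zero)
  qed
  \<comment> \<open>The polar form, from expanding \<open>sin (d \<theta> - \<theta>)\<close>. Its
    \<open>d\<close>-th power has the same argument \<open>d \<theta>\<close> as
    \<open>p \<theta>\<close>, which makes \<open>diag_map\<close> real on the curve.\<close>
  have one_plus: "1 + of_real c * p \<theta> = of_real (sin (real d * \<theta>) / sin (e * \<theta>)) * cis \<theta>"
    if "\<theta> \<in> {0<..b}" for \<theta>
  proof -
    have "e * \<theta> = real d * \<theta> - \<theta>" by (simp add: e_def algebra_simps)
    then have "sin (e * \<theta>) = sin (real d * \<theta>) * cos \<theta> - cos (real d * \<theta>) * sin \<theta>"
      by (simp add: sin_diff)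
    then have "sin (e * \<theta>) + sin \<theta> * cos (real d * \<theta>) = sin (real d * \<theta>) * cos \<theta>" by simp
    then show ?thesis using sinpos[OF that] c0
      by (simp add: p_def complex_eq_iff divide_simps mult_ac)
  qed
  have yp: "diag_map d c (p \<theta>) = of_real (y \<theta>)" if "\<theta> \<in> {0<..b}" for \<theta>
  proof -
    obtain k where k: "d = Suc k" using d by (cases d) auto
    have "(1 + of_real c * p \<theta>) ^ d = of_real ((sin (real d * \<theta>) / sin (e * \<theta>)) ^ d) * cis (real d * \<theta>)"
      by (simp only: one_plus[OF that] power_mult_distrib Complex.DeMoivre of_real_power)
    then have "diag_map d c (p \<theta>) = of_real (sin \<theta> / (c * sin (e * \<theta>)) / (sin (real d * \<theta>) / sin (e * \<theta>)) ^ d)"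
      by (simp add: diag_map_def p_def)
    also have "sin \<theta> / (c * sin (e * \<theta>)) / (sin (real d * \<theta>) / sin (e * \<theta>)) ^ d = y \<theta>"
      using sinpos[OF that] c0 by (simp add: y_def k power_divide)
    finally show ?thesis .
  qed
  have crit: "of_real (1 / (c * e)) \<in> connected_component_set (diag_region d c R) 0"
  proof -
    have "connected (complex_of_real ` {0..1 / (c * e)})"
      by (intro connected_continuous_image continuous_intros) auto
    moreover have "complex_of_real ` {0..1 / (c * e)} \<subseteq> diag_region d c R"
    proof
      fix t assume "t \<in> complex_of_real ` {0..1 / (c * e)}"
      then obtain s where s: "t = of_real s" "0 \<le> s" "s \<le> 1 / (c * e)" by auto
      have pos: "1 + c * s > 0" using s c0 by (simp add: add_pos_nonneg)
      have eq: "1 + of_real c * t = of_real (1 + c * s)" by (simp add: s)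
      have "norm (diag_map d c t) = s / (1 + c * s) ^ d"
        unfolding diag_map_def eq using s pos by (simp add: norm_divide norm_power del: of_real_add of_real_mult)
      also have "\<dots> < 1 / real d ^ d"
        using critical_segment[OF d c s(2)] pos d by (simp add: field_simps)
      finally have "norm (diag_map d c t) < 1 / real d ^ d" .
      moreover have "1 + of_real c * t \<noteq> 0" unfolding eq using pos by (simp del: of_real_add of_real_mult)
      ultimately show "t \<in> diag_region d c R" using s Rc by (simp add: diag_region_def)
    qed
    moreover have "0 \<in> complex_of_real ` {0..1 / (c * e)}" using c0 e by (auto intro!: image_eqI[of _ _ 0])
    ultimately have "complex_of_real ` {0..1 / (c * e)} \<subseteq> connected_component_set (diag_region d c R) 0"
      by (intro connected_component_maximal)
    then show ?thesis by (rule subsetD[OF _ imageI]) (use c0 e in auto)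
  qed
  \<comment> \<open>The curve starts at the critical point. As the component is open, it contains
    \<open>p a\<close> for some small angle \<open>a > 0\<close>.\<close>
  have "(p \<longlongrightarrow> of_real (1 / e / c) * cis (real d * 0)) (at_right 0)"
  proof -
    have "((\<lambda>\<theta>. of_real (sin \<theta> / sin (e * \<theta>) / c) * cis (real d * \<theta>)) \<longlongrightarrow>
             complex_of_real (1 / e / c) * cis (real d * 0)) (at_right 0)"
      using e c0 by (intro tendsto_intros sin_quotient_tendsto tendsto_cis) auto
    then show ?thesis by (simp add: p_def mult.commute[of c])
  qed
  then have "(p \<longlongrightarrow> of_real (1 / (c * e))) (at_right 0)" by (simp add: mult.commute)
  then have "eventually (\<lambda>\<theta>. p \<theta> \<in> connected_component_set (diag_region d c R) 0) (at_right 0)"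
    by (rule topological_tendstoD[OF _ open_connected_component[OF open_diag_region] crit])
  moreover have "eventually (\<lambda>\<theta>. \<theta> \<in> {0<..<b}) (at_right 0)"
    using b(1) by (rule eventually_at_right_real)
  ultimately have "eventually (\<lambda>\<theta>. p \<theta> \<in> connected_component_set (diag_region d c R) 0 \<and> \<theta> \<in> {0<..<b}) (at_right 0)"
    by (rule eventually_conj)
  from eventually_happens'[OF trivial_limit_at_right_real this]
  obtain a where "p a \<in> connected_component_set (diag_region d c R) 0" "a \<in> {0<..<b}" by blast
  then have a: "p a \<in> connected_component_set (diag_region d c R) 0" "0 < a" "a < b" by simp_all
  show False
  proof (rule no_continuation[OF d Rpos, where p = p and y = y and a = a and b = b])
    show "summable (\<lambda>n. of_real (delta d c n) * t ^ n)" if "norm t < R" for t :: complex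
      using conv that by blast
    show "a \<le> b" using a by simp
    show "continuous_on {a..b} p"
    proof -
      have "sin (e * \<theta>) \<noteq> 0" if "\<theta> \<in> {a..b}" for \<theta>
        using sinpos(2)[of \<theta>] that a by auto
      then show ?thesis unfolding p_def using c0 by (intro continuous_intros) auto
    qed
    show "connected_component (diag_region d c R) 0 (p a)" using a by simp
    have b': "b \<in> {0<..b}" using b by simp
    have "c / real d ^ d \<le> sin b * sin (e * b) ^ (d - 1) / sin (real d * b) ^ d"
      using c' d by (simp add: e_def divide_le_eq mult.commute)
    then have "c / real d ^ d / c \<le> sin b * sin (e * b) ^ (d - 1) / sin (real d * b) ^ d / c"
      using c0 by (intro divide_right_mono) auto
    then show "1 / real d ^ d \<le> y b" using c0 by (simp add: y_def mult.commute)
    fix s assume "s \<in> {a..b}"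
    then have s: "s \<in> {0<..b}" using a by auto
    note sinpos = sinpos[OF s]
    show "1 + of_real c * p s \<noteq> 0" unfolding one_plus[OF s] using sinpos by simp
    show "diag_map d c (p s) = of_real (y s)" by (rule yp[OF s])
    show "y s \<ge> 0" using sinpos c0 by (simp add: y_def)
    have "norm (p s) = sin s / sin (e * s) / c"
      using sinpos c0 by (simp add: p_def norm_mult norm_divide mult.commute)
    also have "\<dots> < cs * R / c"
      using close[OF s] c0 by (intro divide_strict_right_mono) (auto simp: cs_def e_def)
    also have "\<dots> \<le> R"
      using c0 Rpos by (simp add: divide_le_eq mult.commute mult_left_mono)
    finally show "norm (p s) < R" .
    \<comment> \<open>The curve runs in the upper half-plane and so avoids the critical point, which
      is real.\<close>
    have "Im (p s) > 0" using sinpos c0 by (simp add: p_def del: of_real_divide of_real_mult)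
    then have "Im (1 - of_real ((real d - 1) * c) * p s) < 0"
      using e c0 unfolding e_def[symmetric] by simp
    then show "1 - of_real ((real d - 1) * c) * p s \<noteq> 0" by (metis less_irrefl zero_complex.simps(2))
  qed
qed

section \<open>Limit of the growth rate\<close>

lemma limsup_root_le:
  fixes x :: "nat \<Rightarrow> real"
  assumes "d > 0" "q > 0" and le: "\<And>n. \<bar>x n\<bar> \<le> M * q ^ (d * n)"
  shows "limsup (\<lambda>n. ereal (\<bar>x n\<bar> powr (1 / (real d * real n)))) \<le> ereal q"
proof -
  \<comment> \<open>Made positive so that \<open>K powr (1 / (d n))\<close> tends to 1.\<close>
  define K where "K = max M 1"
  have K: "K > 0" by (simp add: K_def)
  have "((\<lambda>n. 1 / real d * (1 / real n)) \<longlongrightarrow> 1 / real d * 0) sequentially"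
    by (intro tendsto_intros lim_1_over_n)
  then have "(\<lambda>n. 1 / (real d * real n)) \<longlonglongrightarrow> 0" by simp
  then have "(\<lambda>n. K powr (1 / (real d * real n)) * q) \<longlonglongrightarrow> K powr 0 * q"
    using K by (intro tendsto_intros) auto
  then have lim: "(\<lambda>n. ereal (K powr (1 / (real d * real n)) * q)) \<longlonglongrightarrow> ereal q"
    using K by simp
  have "eventually (\<lambda>n. ereal (\<bar>x n\<bar> powr (1 / (real d * real n))) \<le> ereal (K powr (1 / (real d * real n)) * q)) sequentially"
    using eventually_gt_at_top[of 0]
  proof eventually_elim
    case (elim n)
    have "\<bar>x n\<bar> \<le> K * q ^ (d * n)"
      by (rule order.trans[OF le]) (use assms(2) in \<open>simp add: K_def mult_right_mono\<close>)
    then have "\<bar>x n\<bar> powr (1 / (real d * real n)) \<le> (K * q ^ (d * n)) powr (1 / (real d * real n))"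
      by (intro powr_mono2) auto
    also have "\<dots> = K powr (1 / (real d * real n)) * (q powr (real (d * n))) powr (1 / (real d * real n))"
      unfolding powr_realpow[OF assms(2), symmetric] using K assms(2) by (intro powr_mult)
    also have "(q powr (real (d * n))) powr (1 / (real d * real n)) = q"
      unfolding powr_powr using assms elim by simp
    finally show ?case by simp
  qed
  then have "limsup (\<lambda>n. ereal (\<bar>x n\<bar> powr (1 / (real d * real n)))) \<le>
               limsup (\<lambda>n. ereal (K powr (1 / (real d * real n)) * q))"
    by (rule Limsup_mono)
  also have "\<dots> = ereal q" by (intro lim_imp_Limsup lim) simp
  finally show ?thesis .
qed

lemma summable_limsup_root:
  fixes x :: "nat \<Rightarrow> real" and t :: complex
  assumes d: "d > 0" and l: "l > 0"
    and lim: "limsup (\<lambda>n. ereal (\<bar>x n\<bar> powr (1 / (real d * real n)))) < ereal l"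
    and t: "norm t < 1 / l ^ d"
  shows "summable (\<lambda>n. of_real (x n) * t ^ n)"
proof (rule summable_comparison_test_ev)
  show "summable (\<lambda>n. (l ^ d * norm t) ^ n)"
    by (rule summable_geometric) (use t l in \<open>simp add: field_simps\<close>)
  show "eventually (\<lambda>n. norm (of_real (x n) * t ^ n) \<le> (l ^ d * norm t) ^ n) sequentially"
    using Limsup_lessD[OF lim] eventually_gt_at_top[of 0]
  proof eventually_elim
    case (elim n)
    have "\<bar>x n\<bar> = (\<bar>x n\<bar> powr (1 / (real d * real n))) powr (real (d * n))"
      unfolding powr_powr using d elim by simp
    also have "\<dots> \<le> l powr (real (d * n))" using elim by (intro powr_mono2) auto
    also have "\<dots> = (l ^ d) ^ n" using l by (simp only: powr_realpow power_mult)
    finally show ?case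
      by (simp add: norm_mult norm_power power_mult_distrib mult_right_mono)
  qed
qed

lemma eventually_limsup_less:
  assumes d: "d \<ge> 2" and q: "q > real d - 1"
  shows "eventually (\<lambda>c. limsup (\<lambda>n. ereal (\<bar>delta d c n\<bar> powr (1 / (real d * real n)))) < ereal q)
           (at ((real d - 1) ^ (d - 1)))"
proof -
  define e cs where "e = real d - 1" and "cs = e ^ (d - 1)"
  have e: "e \<ge> 1" using d by (simp add: e_def)
  have cs: "cs > 0" using e by (simp add: cs_def)
  \<comment> \<open>\<open>Y > e / q\<close> puts the rate \<open>e / Y\<close> from
    \<open>delta_upper\<close> below \<open>q\<close>.\<close>
  obtain Y where Y: "e / q < Y" "Y < 1" using q e dense[of "e / q" 1] by (auto simp: e_def)
  have "e / q > 0" using q e by (simp add: e_def)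
  then have Y0: "Y > 0" using Y by linarith
  have "((\<lambda>c. c - cs * (1 - (1 - Y)^2)) \<longlongrightarrow> cs - cs * (1 - (1 - Y)^2)) (at cs)"
    by (intro tendsto_intros)
  then have 1: "eventually (\<lambda>c. c - cs * (1 - (1 - Y)^2) > 0) (at cs)"
    by (rule order_tendstoD) (use cs Y in \<open>simp add: algebra_simps\<close>)
  have "((\<lambda>c. cs - c * Y ^ d) \<longlongrightarrow> cs - cs * Y ^ d) (at cs)"
    by (intro tendsto_intros)
  then have 2: "eventually (\<lambda>c. cs - c * Y ^ d > 0) (at cs)"
    by (rule order_tendstoD) (use cs Y Y0 d in \<open>simp add: power_less_one_iff\<close>)
  have 3: "eventually (\<lambda>c. c > 0) (at cs)"
    by (rule order_tendstoD[OF tendsto_ident_at cs])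
  from 1 2 3 show ?thesis
    unfolding e_def[symmetric] cs_def[symmetric]
  proof eventually_elim
    case (elim c)
    obtain M where "\<And>n. \<bar>delta d c n\<bar> \<le> M * ((real d - 1) / Y) ^ (d * n)"
      by (rule delta_upper[OF d, of c Y]) (use elim Y Y0 in \<open>auto simp: cs_def e_def\<close>)
    then have "limsup (\<lambda>n. ereal (\<bar>delta d c n\<bar> powr (1 / (real d * real n)))) \<le> ereal (e / Y)"
      using d e Y0 by (intro limsup_root_le) (auto simp: e_def)
    also have "ereal (e / Y) < ereal q" using Y Y0 q e by (simp add: field_simps e_def)
    finally show ?case .
  qed
qed

lemma eventually_no_continuation:
  assumes d: "d \<ge> 2" and R: "1 / (real d - 1) ^ d < R"
  shows "eventually (\<lambda>c. \<not> (\<forall>t::complex. norm t < R \<longrightarrow> summable (\<lambda>n. of_real (delta d c n) * t ^ n)))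
           (at ((real d - 1) ^ (d - 1)))"
proof -
  define e cs where "e = real d - 1" and "cs = e ^ (d - 1)"
  have e: "e \<ge> 1" using d by (simp add: e_def)
  have cs: "cs > 0" using e by (simp add: cs_def)
  have ed: "e ^ d = cs * e" using d by (cases d) (auto simp: cs_def)
  have R': "1 / (cs * e) < R" using R by (simp add: e_def[symmetric] ed)
  have "1 / (cs * e) > 0" using cs e by simp
  then have Rpos: "R > 0" using R' by linarith
  \<comment> \<open>The condition \<open>1 / (c * e) < R\<close> solved for \<open>c\<close>: it
    holds on an interval ending at the critical value.\<close>
  have "1 / (R * e) < cs" using R' Rpos cs e by (simp add: field_simps)
  have left: "eventually (\<lambda>c. \<not> (\<forall>t::complex. norm t < R \<longrightarrow> summable (\<lambda>n. of_real (delta d c n) * t ^ n))) (at_left cs)"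
    using eventually_at_left_real[OF \<open>1 / (R * e) < cs\<close>]
  proof eventually_elim
    case (elim c)
    have "0 < 1 / (R * e)" using Rpos e by simp
    moreover have "1 / (R * e) < c" using elim by simp
    ultimately have "c > 0" by (rule less_trans)
    moreover have "1 / (c * e) < R" using elim \<open>c > 0\<close> Rpos e by (simp add: field_simps)
    ultimately show ?case using elim
      by (intro no_continuation_left[OF d]) (auto simp: cs_def e_def)
  qed
  have "1 / e < cs * R" using R' cs e by (simp add: field_simps)
  moreover have "((\<lambda>\<theta>. sin \<theta> / sin (e * \<theta>)) \<longlongrightarrow> 1 / e) (at_right 0)"
    using e by (intro sin_quotient_tendsto) auto
  ultimately have "eventually (\<lambda>\<theta>. sin \<theta> / sin (e * \<theta>) < cs * R) (at_right 0)"
    by (intro order_tendstoD)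
  then obtain b0 where b0: "b0 > 0" "\<And>\<theta>. 0 < \<theta> \<Longrightarrow> \<theta> < b0 \<Longrightarrow> sin \<theta> / sin (e * \<theta>) < cs * R"
    unfolding eventually_at_right_field by auto
  have "min b0 (pi / real d) > 0" using b0(1) d by simp
  \<comment> \<open>\<open>b\<close> is chosen before \<open>c\<close>: up to this angle the curve
    stays in the disc of radius \<open>R\<close> for every \<open>c > cs\<close>, and by angle
    \<open>b\<close> it has reached the singularity for every \<open>c\<close> up to the bound
    \<open>C\<close> below.\<close>
  then obtain b where "0 < b" "b < min b0 (pi / real d)" using dense by blast
  then have b: "0 < b" "b < b0" "b < pi / real d" by simp_all
  define C where "C = real d ^ d * (sin b * sin (e * b) ^ (d - 1) / sin (real d * b) ^ d)"
  have "cs < C" using sin_quotient_gap[OF d b(1,3)] by (simp add: C_def cs_def e_def)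
  have right: "eventually (\<lambda>c. \<not> (\<forall>t::complex. norm t < R \<longrightarrow> summable (\<lambda>n. of_real (delta d c n) * t ^ n))) (at_right cs)"
    using eventually_at_right_real[OF \<open>cs < C\<close>]
  proof eventually_elim
    case (elim c)
    show ?case
      by (rule no_continuation_right[OF d _ _ b(1,3)])
         (use elim R' b b0(2) in \<open>auto simp: C_def cs_def e_def\<close>)
  qed
  show ?thesis
    using left right unfolding e_def[symmetric] cs_def[symmetric] eventually_at_split by blast
qed

text \<open>A limsup below some \<open>l < d - 1\<close> would make the diagonal series converge on
  the disc of radius \<open>1 / l ^ d\<close>, which is larger than \<open>1 / (d - 1) ^ d\<close>;
  near the critical value this is excluded.\<close>

lemma eventually_limsup_greater:
  assumes d: "d \<ge> 2" and q: "a < ereal (real d - 1)"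
  shows "eventually (\<lambda>c. a < limsup (\<lambda>n. ereal (\<bar>delta d c n\<bar> powr (1 / (real d * real n)))))
           (at ((real d - 1) ^ (d - 1)))"
proof -
  \<comment> \<open>\<open>a\<close> may be negative or \<open>-\<infinity>\<close>; the maximum
    with 0 secures a positive real \<open>l\<close>.\<close>
  have "max a 0 < ereal (real d - 1)" using q d by simp
  then obtain l where l: "max a 0 < ereal l" "l < real d - 1"
    using ereal_dense2 by (metis less_ereal.simps(1))
  then have l0: "l > 0" "a < ereal l" by auto
  have "l ^ d < (real d - 1) ^ d" using l l0 d by (intro power_strict_mono) auto
  then have "1 / (real d - 1) ^ d < 1 / l ^ d" using l0 by (simp add: frac_less2)
  from eventually_no_continuation[OF d this] show ?thesis
  proof eventually_elim
    case (elim c)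
    have "\<not> limsup (\<lambda>n. ereal (\<bar>delta d c n\<bar> powr (1 / (real d * real n)))) < ereal l"
    proof
      assume "limsup (\<lambda>n. ereal (\<bar>delta d c n\<bar> powr (1 / (real d * real n)))) < ereal l"
      then have "\<forall>t::complex. norm t < 1 / l ^ d \<longrightarrow> summable (\<lambda>n. of_real (delta d c n) * t ^ n)"
        using summable_limsup_root[of d l "delta d c"] l0(1) d by simp
      with elim show False by blast
    qed
    then show ?case using l0(2) by (meson less_le_trans not_less)
  qed
qed

theorem theorem11:
  fixes d :: nat
  assumes "d \<ge> 2"
  shows "((\<lambda>c::real. limsup (\<lambda>n. ereal (\<bar>delta d c n\<bar> powr (1 / (real d * real n)))))
            \<longlongrightarrow> ereal (real d - 1)) (at ((real d - 1) ^ (d - 1)))"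
proof (rule order_tendstoI)
  fix a :: ereal assume "ereal (real d - 1) < a"
  then obtain q where "ereal (real d - 1) < ereal q" "ereal q < a"
    using ereal_dense2 by blast
  then have "real d - 1 < q" by simp
  from eventually_limsup_less[OF assms this]
  show "eventually (\<lambda>c. limsup (\<lambda>n. ereal (\<bar>delta d c n\<bar> powr (1 / (real d * real n)))) < a)
          (at ((real d - 1) ^ (d - 1)))"
    by (rule eventually_mono) (erule less_trans[OF _ \<open>ereal q < a\<close>])
qed (rule eventually_limsup_greater[OF assms])

end
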